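(* The number of metasylvester classes of words of packed evaluation $(i_1,\ldots,i_r)$ (more precisely, of words having a given evaluation whose nonzero terms are $i_1,\dots,i_r$ in this order) is equal to $$(1+i_r)(1+i_{r-1}+i_r)\cdots(1+i_2+\dots+i_r).$$ The metasylvester class of a packed word $u$ is the set of all words $v$ giving the same result as $u$ by the decreasing tree algorithm described in the context. Moreover, each class has a unique element admitting no elementary rewriting increasing its number of inversions.
   Context: $A=\{1<2<\cdots\}$ is a totally ordered alphabet and $A^*$ the free monoid on $A$. The metasylvester congruence $\equiv_{ms}$ is the equivalence relation on $A^*$ generated by the elementary rewritings: (1) $x\,ab\,y\,a\,z\leftrightarrow x\,ba\,y\,a\,z$ for letters $a<b$; (2) $x\,b\,y\,ac\,z\,b\,t\leftrightarrow x\,b\,y\,ca\,z\,b\,t$ for letters $a<b<c$ (with $x,y,z,t$ arbitrary words). In both cases, the rewriting from left to right increases the number of inversions (pairs of positions $p<q$ with $w_p>w_q$). The evaluation of a word is the sequence whose $i$-th term is the number of occurrences of the letter $i$; the packed evaluation is obtained by removing its zeros. A word is packed if its set of letters is $\{1,\dots,r\}$ for some $r$. Decreasing tree algorithm: it associates with a word $w$ a decreasing tree whose nodes are labeled by the distinct letters of $w$, a node labeled $k$ having $1+|w|_k$ ordered, possibly empty, subtrees ($|w|_k$ is the number of occurrences of $k$ in $w$). It is defined recursively. The root is labeled by the maximal letter $n$ of $w$. The other letters $i$ of $w$ are then inserted one by one in decreasing order, as follows. Consider the smallest $j>i$ such that the last occurrence of $i$ in $w$ lies between two occurrences of $j$.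 If such a $j$ exists, let $k$ be the number of occurrences of $j$ to the left of the last occurrence of $i$; then the $(k+1)$-th subtree of node $j$ is replaced by the tree obtained by applying the algorithm to the restriction of $w$ to the letter $i$ and all the letters already in the $(k+1)$-th subtree of $j$. If no such $j$ exists, the last occurrence of $i$ is either to the left of all occurrences of $n$ or to the right of all of them; in the first (resp. second) case, the leftmost (resp. rightmost) subtree of the root is replaced by the tree obtained by applying the algorithm to the restriction of $w$ to $i$ and all the letters already in that subtree. *)

theory Defs
  imports Main
begin

section \<open>Words, evaluations and inversions\<close>

text \<open>The alphabet is the set of positive natural numbers.\<close>

type_synonym word = "nat list"

definition words :: "word set" where
  "words = lists {1..}"

definition evaluation :: "word \<Rightarrow> nat \<Rightarrow> nat" where
  "evaluation w i = count_list w i"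

text \<open>An evaluation is a finitely supported sequence indexed by the letters; the index \<open>0\<close>,
  which is not a letter, carries the value \<open>0\<close>.\<close>

definition is_evaluation :: "(nat \<Rightarrow> nat) \<Rightarrow> bool" where
  "is_evaluation e \<longleftrightarrow> e 0 = 0 \<and> finite {i. e i \<noteq> 0}"

definition packed_evaluation :: "(nat \<Rightarrow> nat) \<Rightarrow> nat list" where
  "packed_evaluation e = map e (sorted_list_of_set {i. e i \<noteq> 0})"

definition packed :: "word \<Rightarrow> bool" where
  "packed w \<longleftrightarrow> (\<exists>r. set w = {1..r})"

definition inversions :: "word \<Rightarrow> nat" where
  "inversions w = card {(p, q). p < q \<and> q < length w \<and> w ! p > w ! q}"


section \<open>The metasylvester congruence\<close>

inductive ms_rewrite :: "word \<Rightarrow> word \<Rightarrow> bool" where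
  "a < b \<Longrightarrow>
     ms_rewrite (x @ [a, b] @ y @ [a] @ z) (x @ [b, a] @ y @ [a] @ z)"
| "a < b \<Longrightarrow> b < c \<Longrightarrow>
     ms_rewrite (x @ [b] @ y @ [a, c] @ z @ [b] @ t) (x @ [b] @ y @ [c, a] @ z @ [b] @ t)"

definition ms_rel :: "(word \<times> word) set" where
  "ms_rel = {(u, v). u \<in> words \<and> v \<in> words \<and> equivclp ms_rewrite u v}"

text \<open>An elementary rewriting may be used in both directions.\<close>

definition inv_maximal :: "word \<Rightarrow> bool" where
  "inv_maximal w \<longleftrightarrow>
     \<not> (\<exists>w'. (ms_rewrite w w' \<or> ms_rewrite w' w) \<and> inversions w < inversions w')"


section \<open>The decreasing tree algorithm\<close>

datatype dtree = Empty | Node nat "dtree list"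

fun labels :: "dtree \<Rightarrow> nat set" where
  "labels Empty = {}"
| "labels (Node l ts) = insert l (\<Union>t\<in>set ts. labels t)"

text \<open>Subtrees are numbered from \<open>0\<close>, so the \<open>(k+1)\<close>-th subtree of a node is the entry \<open>k\<close> of
  its list of subtrees.  The next two functions give the letters in the \<open>(k+1)\<close>-th subtree of
  the node labeled \<open>j\<close>, and replace that subtree by \<open>R\<close>.\<close>

fun sublabels :: "nat \<Rightarrow> nat \<Rightarrow> dtree \<Rightarrow> nat set" where
  "sublabels j k Empty = {}"
| "sublabels j k (Node l ts) =
     (if l = j then labels (ts ! k) else (\<Union>t\<in>set ts. sublabels j k t))"

fun replace_subtree :: "nat \<Rightarrow> nat \<Rightarrow> dtree \<Rightarrow> dtree \<Rightarrow> dtree" where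
  "replace_subtree j k R Empty = Empty"
| "replace_subtree j k R (Node l ts) =
     (if l = j then Node l (ts[k := R]) else Node l (map (replace_subtree j k R) ts))"

definition last_pos :: "word \<Rightarrow> nat \<Rightarrow> nat" where
  "last_pos w i = Max {p. p < length w \<and> w ! p = i}"

definition encloses :: "word \<Rightarrow> nat \<Rightarrow> nat \<Rightarrow> bool" where
  "encloses w i j \<longleftrightarrow>
     j \<in> set (take (last_pos w i) w) \<and> j \<in> set (drop (Suc (last_pos w i)) w)"

text \<open>The node \<open>j\<close> and the index \<open>k\<close> of the subtree into which the letter \<open>i\<close> is inserted.\<close>

definition slot :: "word \<Rightarrow> nat \<Rightarrow> nat \<times> nat" where
  "slot w i =
     (if \<exists>j>i. encloses w i j
      then let j = (LEAST j. i < j \<and> encloses w i j)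
           in (j, count_list (take (last_pos w i) w) j)
      else let n = Max (set w)
           in (n, if n \<notin> set (take (last_pos w i) w) then 0 else count_list w n))"

text \<open>\<open>insert_letters w ls\<close> is the tree reached after the letters of the increasing list \<open>ls\<close>
  have been processed, from last to first, for the word \<open>w\<close>.\<close>

function insert_letters :: "word \<Rightarrow> nat list \<Rightarrow> dtree" where
  "insert_letters w [] = Empty"
| "insert_letters w [n] = Node n (replicate (1 + count_list w n) Empty)"
| "insert_letters w (i # m # ls) =
     (let T = insert_letters w (m # ls);
          (j, k) = slot w i;
          S = insert i (sublabels j k T);
          w' = filter (\<lambda>x. x \<in> S) w
      in replace_subtree j k (insert_letters w' (sorted_list_of_set (set w'))) T)"
  by pat_completeness auto

text \<open>Termination of this nested recursion rests on the invariant that a node labeled \<open>l\<close> has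
  one more subtree than \<open>l\<close> has occurrences, and that the letters strictly below the root are
  fewer than the letters processed so far.\<close>

fun wft :: "(nat \<Rightarrow> nat) \<Rightarrow> dtree \<Rightarrow> bool" where
  "wft c Empty = True"
| "wft c (Node l ts) = (length ts = 1 + c l \<and> (\<forall>t\<in>set ts. wft c t))"

lemma finite_labels: "finite (labels T)"
  by (induction T) auto

lemma wft_cong: "wft c T \<Longrightarrow> (\<And>l. l \<in> labels T \<Longrightarrow> c l = d l) \<Longrightarrow> wft d T"
  by (induction T) auto

lemma sublabels_subset: "wft c T \<Longrightarrow> k \<le> c j \<Longrightarrow> sublabels j k T \<subseteq> labels T"
proof (induction T)
  case (Node l ts)
  then show ?case
  proof (cases "l = j")
    case True
    then have "ts ! k \<in> set ts" using Node.prems by simp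
    then show ?thesis using True by auto
  next
    case False
    then show ?thesis using Node by (simp only: sublabels.simps labels.simps wft.simps) fastforce
  qed
qed auto

lemma sublabels_root:
  assumes "wft c (Node l ts)" "k \<le> c j"
  shows "sublabels j k (Node l ts) \<subseteq> (\<Union>t\<in>set ts. labels t)"
proof (cases "l = j")
  case True
  then have "ts ! k \<in> set ts" using assms by simp
  then show ?thesis using True by auto
next
  case False
  then show ?thesis using assms sublabels_subset by fastforce
qed

lemma labels_replace: "labels (replace_subtree j k R T) \<subseteq> labels T \<union> labels R"
proof (induction T)
  case (Node l ts)
  have "labels t \<subseteq> (\<Union>t\<in>set ts. labels t) \<union> labels R" if "t \<in> set (ts[k := R])" for t
    using that set_update_subset_insert[of ts k R] by auto
  then have "labels (Node l (ts[k := R])) \<subseteq> labels (Node l ts) \<union> labels R"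
    by (simp only: labels.simps) blast
  moreover have "labels (Node l (map (replace_subtree j k R) ts)) \<subseteq> labels (Node l ts) \<union> labels R"
    using Node by (simp only: labels.simps set_map) blast
  ultimately show ?case by (simp only: replace_subtree.simps split: if_split) blast
qed auto

lemma wft_replace: "wft c T \<Longrightarrow> wft c R \<Longrightarrow> wft c (replace_subtree j k R T)"
proof (induction T)
  case (Node l ts)
  have "wft c t" if "t \<in> set (ts[k := R])" for t
    using that Node.prems set_update_subset_insert[of ts k R] by auto
  then show ?case using Node by auto
qed auto

lemma replace_root:
  obtains ts' where "replace_subtree j k R (Node l ts) = Node l ts'"
    and "(\<Union>t\<in>set ts'. labels t) \<subseteq> (\<Union>t\<in>set ts. labels t) \<union> labels R"
proof (cases "l = j")
  case True
  then show ?thesis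
    using that[of "ts[k := R]"] set_update_subset_insert[of ts k R] by fastforce
next
  case False
  then show ?thesis
    using that[of "map (replace_subtree j k R) ts"] labels_replace by fastforce
qed

lemma count_list_take_le: "count_list (take p w) j \<le> count_list w j"
  by (metis append_take_drop_id count_list_append le_add1)

lemma slot_le: "slot w i = (j, k) \<Longrightarrow> k \<le> count_list w j"
  by (auto simp: slot_def Let_def count_list_take_le split: if_splits)

lemma count_list_filter: "l \<in> S \<Longrightarrow> count_list (filter (\<lambda>x. x \<in> S) w) l = count_list w l"
  by (induction w) auto

definition invar :: "word \<Rightarrow> nat list \<Rightarrow> dtree \<Rightarrow> bool" where
  "invar w ls T \<longleftrightarrow> wft (count_list w) T \<and> labels T \<subseteq> set ls \<and>
     (ls \<noteq> [] \<longrightarrow> (\<exists>n ts. T = Node n ts \<and> card (\<Union>t\<in>set ts. labels t) < length ls))"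

lemma invar_sublabels:
  assumes "invar w (m # ls) T" "slot w i = (j, k)"
  shows "card (insert i (sublabels j k T)) \<le> length (m # ls)"
proof -
  obtain n ts where T: "T = Node n ts" and c: "card (\<Union>t\<in>set ts. labels t) < length (m # ls)"
    using assms by (auto simp: invar_def)
  have "sublabels j k T \<subseteq> (\<Union>t\<in>set ts. labels t)"
    using assms sublabels_root[of "count_list w" n ts k j] slot_le T unfolding invar_def by blast
  moreover have fin: "finite (\<Union>t\<in>set ts. labels t)" using finite_labels by auto
  ultimately have "card (sublabels j k T) < length (m # ls)"
    using c card_mono le_less_trans by blast
  then show ?thesis
    using card_insert_le_m1[of "length (m # ls)" "sublabels j k T" i] by simp
qed

lemma invar_insert_letters:
  "insert_letters_dom (w, ls) \<Longrightarrow> invar w ls (insert_letters w ls)"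
proof (induction w ls rule: insert_letters.pinduct)
  case (1 w)
  then show ?case by (simp add: insert_letters.psimps invar_def)
next
  case (2 w n)
  then show ?case by (auto simp: insert_letters.psimps invar_def)
next
  case (3 w i m ls)
  define T where "T = insert_letters w (m # ls)"
  obtain j k where jk: "slot w i = (j, k)" by (cases "slot w i")
  define S where "S = insert i (sublabels j k T)"
  define w' where "w' = filter (\<lambda>x. x \<in> S) w"
  define R where "R = insert_letters w' (sorted_list_of_set (set w'))"
  have eq: "insert_letters w (i # m # ls) = replace_subtree j k R T"
    using 3(1) by (simp add: insert_letters.psimps Let_def jk T_def S_def w'_def R_def)
  have iT: "invar w (m # ls) T" using 3 by (simp add: T_def)
  have "invar w' (sorted_list_of_set (set w')) R"
    unfolding R_def by (rule 3(3)[OF T_def jk[symmetric] refl S_def w'_def])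
  then have wR: "wft (count_list w') R" and lR: "labels R \<subseteq> set w'"
    by (auto simp: invar_def)
  have S': "set w' \<subseteq> S" by (auto simp: w'_def)
  have wR': "wft (count_list w) R"
    by (rule wft_cong[OF wR]) (use lR S' in \<open>auto simp: w'_def count_list_filter\<close>)
  obtain n ts where T: "T = Node n ts" and c: "card (\<Union>t\<in>set ts. labels t) < length (m # ls)"
    using iT by (auto simp: invar_def)
  have sub: "sublabels j k T \<subseteq> (\<Union>t\<in>set ts. labels t)"
    using iT sublabels_root[of "count_list w" n ts k j] slot_le[OF jk] T
    unfolding invar_def by blast
  have subT: "sublabels j k T \<subseteq> set (m # ls)"
  proof -
    have "(\<Union>t\<in>set ts. labels t) \<subseteq> set (m # ls)"
      using iT unfolding invar_def T labels.simps by blast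
    then show ?thesis using sub by blast
  qed
  obtain ts' where ts': "replace_subtree j k R T = Node n ts'"
    and l': "(\<Union>t\<in>set ts'. labels t) \<subseteq> (\<Union>t\<in>set ts. labels t) \<union> labels R"
    using replace_root[of j k R n ts] T by metis
  have fin: "finite (\<Union>t\<in>set ts. labels t)" using finite_labels by auto
  have "(\<Union>t\<in>set ts'. labels t) \<subseteq> insert i (\<Union>t\<in>set ts. labels t)"
    using l' lR S' sub unfolding S_def by blast
  then have "card (\<Union>t\<in>set ts'. labels t) \<le> card (insert i (\<Union>t\<in>set ts. labels t))"
    using fin by (intro card_mono) auto
  also have "\<dots> < length (i # m # ls)"
    using c card_insert_le_m1[of "length (m # ls)" "\<Union>t\<in>set ts. labels t" i] by simp
  finally have "card (\<Union>t\<in>set ts'. labels t) < length (i # m # ls)" .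
  moreover have "labels (replace_subtree j k R T) \<subseteq> set (i # m # ls)"
  proof -
    have "labels T \<subseteq> set (m # ls)" using iT by (simp only: invar_def)
    moreover have "labels R \<subseteq> insert i (set (m # ls))"
      using lR S' subT unfolding S_def by blast
    ultimately show ?thesis using labels_replace[of j k R T] by (simp only: list.set) blast
  qed
  moreover have "wft (count_list w) (replace_subtree j k R T)"
    using wft_replace wR' iT by (auto simp: invar_def)
  ultimately show ?case unfolding eq invar_def using ts' by blast
qed

termination insert_letters
proof (relation "measure (\<lambda>(w, ls). length ls)", goal_cases)
  case (3 w i m ls T p j k S w')
  have "invar w (m # ls) T" using 3 invar_insert_letters by simp
  then have c: "card S \<le> length (m # ls)" using invar_sublabels 3 by simp
  have "finite S"
    using c 3 finite_subset[OF sublabels_subset[of "count_list w" T k j] finite_labels]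
      slot_le[of w i j k] \<open>invar w (m # ls) T\<close> by (auto simp: invar_def)
  then have "card (set w') \<le> card S" using 3 by (intro card_mono) auto
  then show ?case using c by simp
qed auto

definition dec_tree :: "word \<Rightarrow> dtree" where
  "dec_tree w = insert_letters w (sorted_list_of_set (set w))"

end

theory Submission
  imports Defs
begin

text \<open>
  Call a word aba-free if between two equal letters it has no larger letter.  A word admitting no
  rewriting that increases inversions is aba-free: after an occurrence of \<open>a\<close>, the first letter
  \<open>c > a\<close> that is followed by another \<open>a\<close> can be exchanged with its left neighbour.  Hence every
  class contains an aba-free word.

  The decreasing tree of a word \<open>w\<close> with maximal letter \<open>n\<close> has root \<open>n\<close>, and its subtrees are the
  decreasing trees of restrictions of \<open>w\<close> to disjoint sets of letters: \<open>i\<close> belongs to the subtree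
  reached by passing from \<open>i\<close> to its least encloser until one arrives at \<open>n\<close> or at a letter that is
  not enclosed.  By induction on the length the tree is invariant under rewriting, since in
  rule (2) the least encloser of \<open>a\<close> lies in the same subtree as \<open>a\<close> and can serve as \<open>b\<close>.  For an
  aba-free word those restrictions are the factors between the occurrences of \<open>n\<close>, so the word can be
  read off its tree.  Thus every class contains exactly one aba-free word, and the classes are
  separated by their trees.

  Aba-free words are counted by deleting the smallest letter, whose occurrences are consecutive and
  may be inserted anywhere.
\<close>

section \<open>The insertion slot of a letter\<close>

lemma last_pos_split:
  assumes "i \<notin> set s"
  shows "last_pos (p @ i # s) i = length p"
  unfolding last_pos_def
proof (rule Max_eqI)
  show "finite {q. q < length (p @ i # s) \<and> (p @ i # s) ! q = i}"
    by simp
  show "length p \<in> {q. q < length (p @ i # s) \<and> (p @ i # s) ! q = i}"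
    by simp
  fix q assume "q \<in> {q. q < length (p @ i # s) \<and> (p @ i # s) ! q = i}"
  then have q: "q < length (p @ i # s)" "(p @ i # s) ! q = i" by auto
  show "q \<le> length p"
  proof (rule ccontr)
    assume "\<not> q \<le> length p"
    then obtain r where "q = length p + Suc r"
      using less_imp_Suc_add[of "length p" q] by auto
    with q assms show False
      by (auto simp: nth_append)
  qed
qed

lemma encloses_split:
  "i \<notin> set s \<Longrightarrow> encloses (p @ i # s) i j \<longleftrightarrow> j \<in> set p \<and> j \<in> set s"
  by (simp add: encloses_def last_pos_split)

lemma slot_split:
  assumes "i \<notin> set s"
  shows "slot (p @ i # s) i =
    (if \<exists>j>i. j \<in> set p \<and> j \<in> set s
     then let j = (LEAST j. i < j \<and> j \<in> set p \<and> j \<in> set s) in (j, count_list p j)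
     else let n = Max (set (p @ i # s))
          in (n, if n \<notin> set p then 0 else count_list (p @ i # s) n))"
  unfolding slot_def encloses_split[OF assms] last_pos_split[OF assms]
  by (rule if_cong) simp_all

lemma slot_least_encloser:
  assumes "i \<notin> set s" "i < j" "j \<in> set p" "j \<in> set s"
    and "\<And>j'. i < j' \<Longrightarrow> j' \<in> set p \<Longrightarrow> j' \<in> set s \<Longrightarrow> j \<le> j'"
  shows "slot (p @ i # s) i = (j, count_list p j)"
proof -
  have "(LEAST j. i < j \<and> j \<in> set p \<and> j \<in> set s) = j"
    by (rule Least_equality) (use assms in auto)
  then show ?thesis using assms by (auto simp: slot_split)
qed

lemma slot_no_encloser:
  assumes "i \<notin> set s" "\<And>j'. i < j' \<Longrightarrow> j' \<in> set p \<Longrightarrow> j' \<notin> set s"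
  shows "slot (p @ i # s) i = (Max (set (p @ i # s)),
    if Max (set (p @ i # s)) \<notin> set p then 0 else count_list (p @ i # s) (Max (set (p @ i # s))))"
  using assms by (auto simp: slot_split Let_def)

text \<open>Splitting \<open>w\<close> at the last \<open>i\<close> reduces \<open>slot\<close> to
  membership in a prefix and a suffix: either a least encloser exists, or the slot is an outermost
  one at the root.\<close>

lemma slot_cases:
  assumes "i \<in> set w"
  obtains (enclosed) p s j where "w = p @ i # s" "i \<notin> set s" "i < j" "j \<in> set p" "j \<in> set s"
      "\<And>j'. i < j' \<Longrightarrow> j' \<in> set p \<Longrightarrow> j' \<in> set s \<Longrightarrow> j \<le> j'" "slot w i = (j, count_list p j)"
  | (free) p s where "w = p @ i # s" "i \<notin> set s"
      "\<And>j'. i < j' \<Longrightarrow> j' \<in> set p \<Longrightarrow> j' \<notin> set s"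
      "slot w i = (Max (set w), if Max (set w) \<notin> set p then 0 else count_list w (Max (set w)))"
proof -
  obtain p s where w: "w = p @ i # s" "i \<notin> set s"
    using split_list_last[OF assms] by blast
  show thesis
  proof (cases "\<exists>j>i. j \<in> set p \<and> j \<in> set s")
    case True
    then obtain j where j: "i < j" "j \<in> set p" "j \<in> set s"
      "\<And>j'. i < j' \<Longrightarrow> j' \<in> set p \<Longrightarrow> j' \<in> set s \<Longrightarrow> j \<le> j'"
      using exists_least_iff[of "\<lambda>j. i < j \<and> j \<in> set p \<and> j \<in> set s"] by (meson not_le)
    show ?thesis
      using enclosed[OF w j] slot_least_encloser[OF w(2) j] w by simp
  next
    case False
    then show ?thesis using free[OF w] slot_no_encloser[OF w(2)] w by blast
  qed
qed

text \<open>Passing from a letter to the node it is inserted under strictly climbs within the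
  letters of \<open>w\<close>, which is what makes \<open>letter_induct\<close> an
  induction.\<close>

lemma slot_fst:
  assumes "i \<in> set w" "i < Max (set w)"
  shows "i < fst (slot w i)" "fst (slot w i) \<in> set w" "fst (slot w i) \<le> Max (set w)"
proof -
  have "i < fst (slot w i) \<and> fst (slot w i) \<in> set w"
    using assms(1)
  proof (cases rule: slot_cases)
    case (free p s)
    have "Max (set w) \<in> set w" by (rule Max_in) (use assms in auto)
    then show ?thesis using free(4) assms(2) by simp
  qed auto
  then show "i < fst (slot w i)" "fst (slot w i) \<in> set w" "fst (slot w i) \<le> Max (set w)"
    by auto
qed

text \<open>The numbers of \<open>j\<close>'s to the left of the last \<open>i\<close> may differ in the two words as long as a
  smaller letter encloses \<open>i\<close>; this happens in rule (2).\<close>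

lemma slot_cong:
  assumes u: "u = p @ i # q" "i \<notin> set q" and v: "v = p' @ i # q'" "i \<notin> set q'"
    and M: "Max (set u) = Max (set v)" "i < Max (set u)"
    and c: "count_list u (Max (set u)) = count_list v (Max (set u))"
    and *: "\<And>j. i < j \<Longrightarrow> count_list p j = count_list p' j \<and> (j \<in> set q \<longleftrightarrow> j \<in> set q') \<or>
      (\<exists>b. i < b \<and> b < j \<and> b \<in> set p \<and> b \<in> set q \<and> b \<in> set p' \<and> b \<in> set q')"
  shows "slot u i = slot v i"
proof -
  have p: "j \<in> set p \<longleftrightarrow> j \<in> set p'" if "count_list p j = count_list p' j" for j
    using that by (metis count_list_0_iff)
  have "i \<in> set u" using u by simp
  then show ?thesis
  proof (cases rule: slot_cases)
    case (enclosed p0 q0 j)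
    have [simp]: "p0 = p" "q0 = q"
      using u enclosed(1,2) append_Cons_eq_iff[of i p q p0 q0]
      by (auto simp: append_eq_append_conv2 append_eq_Cons_conv Cons_eq_append_conv)
    \<comment> \<open>Minimality of \<open>j\<close> excludes the second alternative of the last
      assumption at \<open>j\<close>, so the two words agree on \<open>j\<close>.\<close>
    have min: "\<not> (i < b \<and> b < j \<and> b \<in> set p \<and> b \<in> set q)" for b
      using enclosed(6)[of b] by auto
    then have j: "count_list p j = count_list p' j" "j \<in> set q \<longleftrightarrow> j \<in> set q'"
      using *[of j] enclosed by auto
    have "slot (p' @ i # q') i = (j, count_list p' j)"
    proof (rule slot_least_encloser[OF v(2) enclosed(3)])
      show "j \<in> set p'" "j \<in> set q'" using enclosed j p by auto
      fix j' assume j': "i < j'" "j' \<in> set p'" "j' \<in> set q'"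
      show "j \<le> j'"
      proof (rule ccontr)
        assume "\<not> j \<le> j'"
        then show False using *[OF j'(1)] p[of j'] min[of j'] j' min
          by (metis linorder_not_le order.strict_trans)
      qed
    qed
    then show ?thesis using enclosed j v by simp
  next
    case (free p0 q0)
    have [simp]: "p0 = p" "q0 = q"
      using u free(1,2)
      by (auto simp: append_eq_append_conv2 append_eq_Cons_conv Cons_eq_append_conv)
    have eq: "count_list p j = count_list p' j" "j \<in> set q \<longleftrightarrow> j \<in> set q'" if "i < j" for j
      using *[OF that] free(3) by auto
    have "slot (p' @ i # q') i = (Max (set v),
        if Max (set v) \<notin> set p' then 0 else count_list v (Max (set v)))"
      unfolding v(1) by (rule slot_no_encloser[OF v(2)]) (use free(3) eq p in auto)
    then show ?thesis using free(4) v(1) M eq p c by auto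
  qed
qed

section \<open>Slots in restrictions of a word\<close>

lemma Max_filter_upper:
  assumes "i \<in> set w" "\<And>x. x \<in> set w \<Longrightarrow> i \<le> x \<Longrightarrow> P x"
  shows "Max (set (filter P w)) = Max (set w)"
proof (rule Max_eqI)
  have "Max (set w) \<in> set w" by (rule Max_in) (use assms in auto)
  then show "Max (set w) \<in> set (filter P w)" using assms by auto
qed auto

lemma count_list_filter_if: "count_list (filter P w) x = (if P x then count_list w x else 0)"
  by (induction w) auto

text \<open>The slot of \<open>i\<close> is computed from the letters above \<open>i\<close>, so
  deleting smaller letters does not move it.\<close>

lemma slot_filter_upper:
  assumes "i \<in> set w" "\<And>x. x \<in> set w \<Longrightarrow> i \<le> x \<Longrightarrow> P x" "i < Max (set w)"
  shows "slot (filter P w) i = slot w i"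
proof -
  obtain p s where w: "w = p @ i # s" "i \<notin> set s"
    using split_list_last[OF assms(1)] by blast
  have M: "Max (set (filter P w)) = Max (set w)" by (rule Max_filter_upper) (use assms in auto)
  have "Max (set w) \<in> set w" by (rule Max_in) (use assms in auto)
  then have PM: "P (Max (set w))" using assms by simp
  show ?thesis
  proof (rule slot_cong[of _ "filter P p" i "filter P s" _ p s])
    show "filter P w = filter P p @ i # filter P s" using w assms(1,2) by simp
    fix j assume "i < j"
    then have "P j \<or> j \<notin> set w" using assms(2)[of j] by auto
    then show "count_list (filter P p) j = count_list p j \<and> (j \<in> set (filter P s) \<longleftrightarrow> j \<in> set s) \<or>
      (\<exists>b. i < b \<and> b < j \<and> b \<in> set (filter P p) \<and> b \<in> set (filter P s) \<and> b \<in> set p \<and> b \<in> set s)"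
      using w by (auto simp: count_list_filter_if)
  qed (use w M PM assms in \<open>auto simp: count_list_filter_if\<close>)
qed

text \<open>Since \<open>j\<close> is not the maximum, \<open>i\<close> is enclosed. A restriction
  can only remove competitors of the least encloser \<open>j\<close>, and \<open>j\<close> keeps all
  its occurrences.\<close>

lemma slot_filter_encloser:
  assumes "i \<in> set w" "slot w i = (j, k)" "j \<noteq> Max (set w)" "P i" "P j"
  shows "slot (filter P w) i = (j, k)"
  using assms(1)
proof (cases rule: slot_cases)
  case (enclosed p s j')
  have [simp]: "j' = j" using enclosed assms by simp
  have "slot (filter P p @ i # filter P s) i = (j, count_list (filter P p) j)"
    by (rule slot_least_encloser) (use enclosed assms in auto)
  then show ?thesis using enclosed assms by (simp add: count_list_filter_if)
qed (use assms in auto)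

section \<open>The subtrees of a decreasing tree\<close>

text \<open>Discharges the domain premise of \<open>invar_insert_letters\<close>, so that the
  invariant holds for all arguments.\<close>

lemma insert_letters_dom: "insert_letters_dom (w, ls)"
proof -
  have "All insert_letters_dom"
  proof (rule insert_letters.termination[of "measure (\<lambda>(w, ls). length ls)"], goal_cases)
    case (3 w i m ls T p j k S w')
    have iT: "invar w (m # ls) T" using 3 invar_insert_letters by simp
    \<comment> \<open>The nested call processes at most \<open>card S\<close> letters, which by the
      invariant is fewer than the current call has.\<close>
    then have c: "card S \<le> length (m # ls)" using invar_sublabels 3 by simp
    have "sublabels j k T \<subseteq> labels T"
      using iT 3 slot_le[of w i j k] by (intro sublabels_subset) (auto simp: invar_def)
    then have "finite S"
      using 3(4) finite_subset[OF _ finite_labels] by auto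
    then have "card (set w') \<le> card S" using 3 by (intro card_mono) auto
    then show ?case using c by simp
  qed auto
  then show ?thesis by blast
qed

lemma invar_insert_letters_total: "invar w ls (insert_letters w ls)"
  by (rule invar_insert_letters[OF insert_letters_dom])

lemma labels_insert_letters: "labels (insert_letters w ls) \<subseteq> set ls"
  using invar_insert_letters_total[of w ls] by (simp only: invar_def)

text \<open>When \<open>ls\<close> is upward closed, its insertion never consults smaller letters:
  slots see larger letters only, and each nested call is restricted to letters of
  \<open>ls\<close>.\<close>

lemma insert_letters_filter:
  assumes "sorted_wrt (<) ls" "set ls \<subseteq> set w" "\<And>x y. x \<in> set ls \<Longrightarrow> y \<in> set w \<Longrightarrow> x \<le> y \<Longrightarrow> y \<in> set ls"
  shows "insert_letters (filter (\<lambda>x. x \<in> set ls) w) ls = insert_letters w ls"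
  using assms
proof (induction ls arbitrary: w rule: induct_list012)
  case (3 i m ls)
  let ?A = "set (i # m # ls)"
  let ?v = "filter (\<lambda>x. x \<in> ?A) w"
  have up: "y \<in> set (m # ls)" if "x \<in> set (m # ls)" "y \<in> set w" "x \<le> y" for x y
  proof -
    have "y \<in> ?A" using that 3(5)[of x y] by simp
    moreover have "y \<noteq> i" using that 3(3) by auto
    ultimately show ?thesis by simp
  qed
  have T: "insert_letters (filter (\<lambda>x. x \<in> set (m # ls)) w) (m # ls) = insert_letters w (m # ls)"
    by (rule 3(2)) (use 3(3-5) up in auto)
  have "insert_letters (filter (\<lambda>x. x \<in> set (m # ls)) ?v) (m # ls) = insert_letters ?v (m # ls)"
    by (rule 3(2)) (use 3(3-5) up in auto)
  moreover have "filter (\<lambda>x. x \<in> set (m # ls)) ?v = filter (\<lambda>x. x \<in> set (m # ls)) w"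
    by (auto intro: filter_cong)
  ultimately have T': "insert_letters ?v (m # ls) = insert_letters w (m # ls)"
    using T by simp
  have "m \<le> Max (set w)" using 3(4) by (intro Max_ge) auto
  moreover have "i < m" using 3(3) by simp
  ultimately have "i < Max (set w)" by linarith
  then have slot: "slot ?v i = slot w i"
    using 3(4) 3(5)[of i] by (intro slot_filter_upper) auto
  obtain j k where jk: "slot w i = (j, k)" by (cases "slot w i")
  let ?S = "insert i (sublabels j k (insert_letters w (m # ls)))"
  have "sublabels j k (insert_letters w (m # ls)) \<subseteq> labels (insert_letters w (m # ls))"
    using invar_insert_letters_total[of w "m # ls"] slot_le[OF jk]
    unfolding invar_def by (intro sublabels_subset) blast+
  then have "?S \<subseteq> ?A" using labels_insert_letters[of w "m # ls"] by auto
  then have "filter (\<lambda>x. x \<in> ?S) ?v = filter (\<lambda>x. x \<in> ?S) w"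
    by (auto intro: filter_cong)
  then show ?case
    by (simp only: insert_letters.simps slot jk T' Let_def case_prod_conv)
qed (auto simp: count_list_filter_if)

lemma dec_tree_Nil [simp]: "dec_tree [] = Empty"
  by (simp add: dec_tree_def)

lemma dec_tree_singleton:
  "set w = {n} \<Longrightarrow> dec_tree w = Node n (replicate (1 + count_list w n) Empty)"
  by (simp add: dec_tree_def)

text \<open>The smallest letter is inserted last, and the tree built before that is the tree of the
  word without it. This turns the algorithm into a recursion on words.\<close>

lemma dec_tree_rec:
  assumes "i \<in> set w" "i < Max (set w)" "\<And>x. x \<in> set w \<Longrightarrow> i \<le> x" "slot w i = (j, k)"
  defines "T \<equiv> dec_tree (filter (\<lambda>x. x \<noteq> i) w)"
  shows "dec_tree w =
    replace_subtree j k (dec_tree (filter (\<lambda>x. x \<in> insert i (sublabels j k T)) w)) T"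
proof -
  let ?A = "set w - {i}"
  have M: "Max (set w) \<in> set w" by (rule Max_in) (use assms in auto)
  have "sorted_list_of_set (insert i ?A) = i # sorted_list_of_set ?A"
    using assms(3) by (subst sorted_list_of_set_insert) (auto intro!: insort_is_Cons)
  then have ls: "sorted_list_of_set (set w) = i # sorted_list_of_set ?A"
    using assms(1) by (simp add: insert_absorb)
  obtain m ls where ml: "sorted_list_of_set ?A = m # ls"
    using M assms(2) by (cases "sorted_list_of_set ?A") (auto simp: sorted_list_of_set_eq_Nil_iff)
  have sml: "set (m # ls) = ?A" using ml by (metis List.finite_set finite_Diff set_sorted_list_of_set)
  have "filter (\<lambda>x. x \<in> set (m # ls)) w = filter (\<lambda>x. x \<noteq> i) w"
    unfolding sml by (auto intro: filter_cong)
  moreover have "insert_letters (filter (\<lambda>x. x \<in> set (m # ls)) w) (m # ls) = insert_letters w (m # ls)"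
  proof (rule insert_letters_filter)
    show "sorted_wrt (<) (m # ls)" unfolding ml[symmetric] by simp
    show "set (m # ls) \<subseteq> set w" using sml by auto
    fix x y assume "x \<in> set (m # ls)" "y \<in> set w" "x \<le> y"
    then show "y \<in> set (m # ls)" using assms(3)[of x] unfolding sml by auto
  qed
  moreover have "set (filter (\<lambda>x. x \<noteq> i) w) = ?A" by auto
  ultimately have T: "insert_letters w (m # ls) = T"
    by (simp add: T_def dec_tree_def ml)
  show ?thesis
    unfolding dec_tree_def[of w] ls ml
    by (simp only: insert_letters.simps T assms(4) Let_def case_prod_conv dec_tree_def[symmetric])
qed

section \<open>Climbing from a letter to the root\<close>

text \<open>The index of the subtree of the root that contains the letter \<open>i\<close> below the root.\<close>

function root_slot :: "word \<Rightarrow> nat \<Rightarrow> nat" where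
  "root_slot w i = (let (j, k) = slot w i in if i < j \<and> j < Max (set w) then root_slot w j else k)"
  by pat_completeness auto
text \<open>The test \<open>i < j\<close> makes the measure drop for arbitrary arguments; for
  letters below the maximum it holds by \<open>slot_fst\<close>.\<close>

termination
  by (relation "measure (\<lambda>(w, i). Max (set w) - i)") auto

declare root_slot.simps [simp del]

lemma root_slot_root: "slot w i = (j, k) \<Longrightarrow> j = Max (set w) \<Longrightarrow> root_slot w i = k"
  by (simp add: root_slot.simps[of w i])

lemma root_slot_step:
  assumes "slot w i = (j, k)" "j \<noteq> Max (set w)" "i \<in> set w" "i < Max (set w)"
  shows "root_slot w i = root_slot w j"
proof -
  have "i < j" "j \<le> Max (set w)" using slot_fst[OF assms(3,4)] assms(1) by auto
  moreover from this have "j < Max (set w)" using assms(2) by linarith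
  ultimately show ?thesis by (simp add: root_slot.simps[of w i] assms(1))
qed

text \<open>Induction along the climb from a letter to the node above it: the gap to the maximum
  shrinks until the maximum is reached.\<close>

lemma letter_induct [consumes 2, case_names root step]:
  assumes "i \<in> set w" "i < Max (set w)"
    and root: "\<And>i k. i \<in> set w \<Longrightarrow> i < Max (set w) \<Longrightarrow> slot w i = (Max (set w), k) \<Longrightarrow> P i"
    and step: "\<And>i j k. i \<in> set w \<Longrightarrow> i < j \<Longrightarrow> j \<in> set w \<Longrightarrow> j < Max (set w) \<Longrightarrow>
      slot w i = (j, k) \<Longrightarrow> P j \<Longrightarrow> P i"
  shows "P i"
  using assms(1,2)
proof (induction "Max (set w) - i" arbitrary: i rule: less_induct)
  case less
  obtain j k where jk: "slot w i = (j, k)" by (cases "slot w i")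
  have j: "i < j" "j \<in> set w" "j \<le> Max (set w)" using slot_fst[OF less(2,3)] jk by auto
  show ?case
  proof (cases "j = Max (set w)")
    case True
    then show ?thesis using root less jk by blast
  next
    case False
    then have "j < Max (set w)" using j by linarith
    then show ?thesis using step[OF less(2) j(1,2) _ jk] less(1)[of j] j by simp
  qed
qed

text \<open>Makes \<open>root_slot\<close> a legal index into the subtrees of the root; the bound
  comes from the last link of the climb.\<close>

lemma root_slot_le:
  assumes "i \<in> set w" "i < Max (set w)"
  shows "root_slot w i \<le> count_list w (Max (set w))"
  using assms
proof (induction rule: letter_induct)
  case (root i k)
  then show ?case using slot_le root_slot_root by metis
next
  case (step i j k)
  then show ?case using root_slot_step[OF step(5)] by simp
qed

text \<open>The climb from \<open>i\<close> visits only letters \<open>x\<close> with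
  \<open>i \<le> x\<close> before it reaches the maximum, so agreement of the slots there
  suffices.\<close>

lemma root_slot_cong:
  assumes "i \<in> set u" "i < Max (set u)" "Max (set u) = Max (set v)"
    "\<And>x. x \<in> set u \<Longrightarrow> i \<le> x \<Longrightarrow> x < Max (set u) \<Longrightarrow> x \<in> set v \<and> slot u x = slot v x"
  shows "root_slot u i = root_slot v i"
  using assms(1,2,4)
proof (induction rule: letter_induct)
  case (root i k)
  then show ?case using assms(3) by (simp add: root_slot_root)
next
  case (step i j k)
  have "slot v i = (j, k)" "i \<in> set v" using step by auto
  then have "root_slot v i = root_slot v j"
    using step assms(3) by (intro root_slot_step) auto
  moreover have "root_slot u i = root_slot u j"
    using step by (intro root_slot_step) auto
  moreover have "root_slot u j = root_slot v j"
    by (rule step(6)) (use step in auto)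
  ultimately show ?case by simp
qed

text \<open>A restriction to whole letters, hence in general not a factor between occurrences of the
  maximum: for \<open>[1, 3, 1]\<close> both letters \<open>1\<close> go to child
  \<open>1\<close>.\<close>

definition root_child :: "word \<Rightarrow> nat \<Rightarrow> word" where
  "root_child w k = filter (\<lambda>x. x \<noteq> Max (set w) \<and> root_slot w x = k) w"

lemma set_root_child: "set (root_child w k) = {x \<in> set w. x < Max (set w) \<and> root_slot w x = k}"
proof -
  have "x < Max (set w) \<longleftrightarrow> x \<noteq> Max (set w)" if "x \<in> set w" for x
    using Max_ge[OF _ that] by (metis List.finite_set nless_le)
  then show ?thesis by (auto simp: root_child_def)
qed

lemma length_root_child: "w \<noteq> [] \<Longrightarrow> length (root_child w k) < length w"
proof -
  assume "w \<noteq> []"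
  then have "Max (set w) \<in> set w" by simp
  then show ?thesis unfolding root_child_def by (intro length_filter_less[of "Max (set w)"]) auto
qed

lemma sublabels_notin: "j \<notin> labels T \<Longrightarrow> sublabels j k T = {}"
  by (induction T) auto

lemma replace_subtree_notin: "j \<notin> labels T \<Longrightarrow> replace_subtree j k R T = T"
  by (induction T) (auto intro: map_idI)

text \<open>Remove the smallest letter \<open>i\<close>, which is inserted last and alters one
  subtree of the root. If \<open>i\<close> hangs directly under the root, the nested call is run on
  the enlarged child. Otherwise it hangs under a node \<open>j\<close> of some child, and the
  insertion there is the one performed by the algorithm on that child alone. The labels are carried
  along in order to locate \<open>j\<close>.\<close>

lemma dec_tree_children:
  assumes "w \<noteq> []"
  shows "dec_tree w = Node (Max (set w))
      (map (\<lambda>k. dec_tree (root_child w k)) [0..<Suc (count_list w (Max (set w)))])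
    \<and> labels (dec_tree w) = set w"
  using assms
proof (induction "length w" arbitrary: w rule: less_induct)
  case less
  define n where "n = Max (set w)"
  have n: "n \<in> set w" unfolding n_def using less(2) by simp
  have le_n: "x \<le> n" if "x \<in> set w" for x using that unfolding n_def by (intro Max_ge) simp_all
  have IHl: "labels (dec_tree v) = set v" if "length v < length w" for v
    using less(1)[OF that] dec_tree_Nil by (cases "v = []") (simp_all only: labels.simps list.set, blast)
  have "dec_tree w = Node n (map (\<lambda>k. dec_tree (root_child w k)) [0..<Suc (count_list w n)])"
  proof (cases "set w = {n}")
    case True
    then have "set (root_child w k) = {}" for k
      unfolding set_root_child n_def[symmetric] by auto
    then have "root_child w k = []" for k by simp
    moreover have "map (\<lambda>k. Empty) [0..<m] = replicate m Empty" for m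
      by (simp add: map_replicate_const)
    ultimately show ?thesis using dec_tree_singleton[OF True] by (simp only: dec_tree_Nil) simp
  next
    case False
    define i where "i = Min (set w)"
    have i: "i \<in> set w" unfolding i_def using less(2) by simp
    have i_le: "i \<le> x" if "x \<in> set w" for x using that unfolding i_def by (intro Min_le) simp_all
    have "i < n"
    proof -
      obtain x where "x \<in> set w" "x \<noteq> n" using False n by blast
      then show ?thesis using i_le[of x] le_n[of x] by simp
    qed
    define u where "u = filter (\<lambda>x. x \<noteq> i) w"
    have lu: "length u < length w"
      unfolding u_def by (rule length_filter_less[OF i]) simp
    have nu: "n \<in> set u" using n \<open>i < n\<close> by (simp add: u_def)
    have Mu: "Max (set u) = n" unfolding n_def u_def
      by (rule Max_filter_upper[of n]) (use n \<open>i < n\<close> in \<open>auto simp: n_def\<close>)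
    have cu: "count_list u n = count_list w n"
      using \<open>i < n\<close> by (simp add: u_def count_list_filter_if)
    \<comment> \<open>Slots depend on larger letters only and the climb from \<open>x\<close> stays
      at or above \<open>x\<close>, so deleting \<open>i\<close> changes no root index.\<close>
    have ru: "root_slot u x = root_slot w x" if "x \<in> set u" "x < n" for x
    proof (rule root_slot_cong)
      fix y assume y: "y \<in> set u" "x \<le> y" "y < Max (set u)"
      have "slot u y = slot w y" unfolding u_def
        by (rule slot_filter_upper) (use y i_le Mu in \<open>auto simp: u_def n_def\<close>, use i_le le_antisym in fastforce)
      then show "y \<in> set w \<and> slot u y = slot w y" using y by (auto simp: u_def)
    qed (use that Mu in \<open>auto simp: n_def u_def\<close>)
    \<comment> \<open>Deleting \<open>i\<close> thus commutes with passing to a child.\<close>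
    have rcu: "root_child u q = filter (\<lambda>x. x \<noteq> i) (root_child w q)" for q
    proof -
      have "filter (\<lambda>x. x \<noteq> n \<and> root_slot u x = q) u = filter (\<lambda>x. x \<noteq> n \<and> root_slot w x = q) u"
      proof (rule filter_cong[OF refl])
        fix x assume x: "x \<in> set u"
        then have "x \<le> n" by (intro le_n) (simp add: u_def)
        then show "(x \<noteq> n \<and> root_slot u x = q) = (x \<noteq> n \<and> root_slot w x = q)"
          using ru[OF x] by auto
      qed
      then show ?thesis
        unfolding root_child_def Mu n_def[symmetric] by (simp add: u_def conj_ac)
    qed
    define T where "T = dec_tree u"
    define ts where "ts = map (\<lambda>q. dec_tree (root_child u q)) [0..<Suc (count_list w n)]"
    have T: "T = Node n ts"
    proof -
      have "u \<noteq> []" using nu by auto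
      then show ?thesis using less(1)[OF lu] unfolding T_def ts_def Mu cu by blast
    qed
    have nth_ts: "ts ! q = dec_tree (root_child u q)" if "q \<le> count_list w n" for q
      unfolding ts_def using that by (simp del: upt_Suc)
    have lts: "labels (dec_tree (root_child u q)) = set (root_child u q)" for q
      by (rule IHl) (use length_root_child[of u q] lu nu in fastforce)
    obtain j k where jk: "slot w i = (j, k)" by (cases "slot w i")
    have j: "i < j" "j \<in> set w" "j \<le> n"
      using slot_fst[OF i] \<open>i < n\<close> jk by (auto simp: n_def)
    let ?F = "\<lambda>S. filter (\<lambda>x. x \<in> insert i S) w"
    have rec: "dec_tree w = replace_subtree j k (dec_tree (?F (sublabels j k T))) T"
      unfolding T_def u_def by (rule dec_tree_rec[OF i _ i_le jk]) (use \<open>i < n\<close> n_def in auto)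
    have wq: "root_child w q = root_child u q" if "root_slot w i \<noteq> q" for q
      unfolding rcu using that by (subst filter_True) (auto simp: root_child_def)
    show ?thesis
    proof (cases "j = n")
      case True
      have k: "root_slot w i = k" using root_slot_root jk True n_def by blast
      have kle: "k \<le> count_list w n" using slot_le[OF jk] True by simp
      \<comment> \<open>The word of the nested call is exactly child \<open>k\<close> of
        \<open>w\<close>.\<close>
      have "?F (set (root_child u k)) = root_child w k"
        unfolding root_child_def[of w]
      proof (rule filter_cong[OF refl])
        fix x assume x: "x \<in> set w"
        have "i \<noteq> n" "x < n \<longleftrightarrow> x \<noteq> n" using \<open>i < n\<close> le_n[OF x] by linarith+
        then show "x \<in> insert i (set (root_child u k)) \<longleftrightarrow> x \<noteq> Max (set w) \<and> root_slot w x = k"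
          using x k unfolding rcu set_filter set_root_child n_def[symmetric] by auto
      qed
      then have "dec_tree w = Node n (ts[k := dec_tree (root_child w k)])"
        unfolding rec T using True kle by (simp add: nth_ts lts)
      also have "ts[k := dec_tree (root_child w k)] = map (\<lambda>q. dec_tree (root_child w q)) [0..<Suc (count_list w n)]"
      proof (rule nth_equalityI)
        fix r assume "r < length (ts[k := dec_tree (root_child w k)])"
        then have r: "r < Suc (count_list w n)" by (simp add: ts_def)
        then show "ts[k := dec_tree (root_child w k)] ! r =
            map (\<lambda>q. dec_tree (root_child w q)) [0..<Suc (count_list w n)] ! r"
          using kle wq[of r] k by (cases "r = k") (simp_all add: ts_def del: upt_Suc)
      qed (simp add: ts_def)
      finally show ?thesis .
    next
      case False
      define q where "q = root_slot w i"
      have qj: "q = root_slot w j" unfolding q_def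
        by (rule root_slot_step[OF jk]) (use False i \<open>i < n\<close> in \<open>auto simp: n_def\<close>)
      have jn: "j < n" using j False by simp
      have qle: "q \<le> count_list w n"
        unfolding qj n_def by (rule root_slot_le) (use j jn n_def in auto)
      define v where "v = root_child w q"
      have iv: "i \<in> set v" and jv: "j \<in> set v"
        unfolding v_def set_root_child n_def[symmetric]
        using i \<open>i < n\<close> j jn qj q_def by auto
      \<comment> \<open>The node \<open>j\<close> occurs in child \<open>q\<close> only, so reading
        and replacing its subtree leave the other children alone.\<close>
      have ju: "j \<in> labels (dec_tree (root_child u r)) \<longleftrightarrow> r = q" for r
        unfolding lts unfolding rcu set_filter set_root_child n_def[symmetric] using j jn qj by auto
      have vi: "filter (\<lambda>x. x \<noteq> i) v = root_child u q" by (simp add: rcu v_def)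
      \<comment> \<open>Inside child \<open>q\<close> the letter \<open>i\<close> keeps its slot:
        its least encloser \<open>j\<close> is not the root and survives the restriction.\<close>
      have sv: "slot v i = (j, k)"
        unfolding v_def root_child_def
        by (rule slot_filter_encloser[OF i jk]) (use False i \<open>i < n\<close> qj q_def n_def in auto)
      have "j \<le> Max (set v)" using jv by simp
      then have recv: "dec_tree v = replace_subtree j k (dec_tree (filter (\<lambda>x. x \<in> insert i
          (sublabels j k (dec_tree (root_child u q)))) v)) (dec_tree (root_child u q))"
        unfolding vi[symmetric]
        by (intro dec_tree_rec[OF iv _ _ sv]) (use j i_le in \<open>auto simp: v_def root_child_def\<close>)
      have "sublabels j k T = (\<Union>r\<in>{0..<Suc (count_list w n)}. sublabels j k (dec_tree (root_child u r)))"
        unfolding T ts_def using False by (simp del: upt_Suc)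
      also have "\<dots> = sublabels j k (dec_tree (root_child u q))"
      proof -
        have "sublabels j k (dec_tree (root_child u r)) = {}" if "r \<noteq> q" for r
          by (rule sublabels_notin) (use ju that in blast)
        then show ?thesis using qle by fastforce
      qed
      finally have subT: "sublabels j k T = sublabels j k (dec_tree (root_child u q))" .
      have "sublabels j k (dec_tree (root_child u q)) \<subseteq> set v"
      proof -
        have "wft (count_list (root_child u q)) (dec_tree (root_child u q))"
          using invar_insert_letters_total unfolding dec_tree_def invar_def by blast
        moreover have "k \<le> count_list (root_child u q) j"
        proof -
          have "count_list (root_child u q) j = count_list v j"
            using j by (simp add: vi[symmetric] count_list_filter_if)
          then show ?thesis using slot_le[OF sv] by simp
        qed
        ultimately show ?thesis using sublabels_subset lts[of q] rcu v_def by fastforce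
      qed
      \<comment> \<open>The nested calls for \<open>w\<close> and for its child \<open>v\<close>
        therefore receive the same word.\<close>
      then have Fv: "?F (sublabels j k T) = filter (\<lambda>x. x \<in> insert i (sublabels j k (dec_tree (root_child u q)))) v"
        unfolding subT v_def root_child_def using iv v_def by (auto simp: root_child_def intro!: filter_cong)
      have "replace_subtree j k (dec_tree (?F (sublabels j k T))) (dec_tree (root_child u r))
          = dec_tree (root_child w r)" for r
      proof (cases "r = q")
        case True
        then show ?thesis using recv Fv by (simp add: v_def)
      next
        case False
        then show ?thesis using replace_subtree_notin ju wq q_def by metis
      qed
      then show ?thesis
        unfolding rec using False by (simp add: T ts_def del: upt_Suc)
    qed
  qed
  \<comment> \<open>By \<open>root_slot_le\<close> every letter other than \<open>n\<close> belongs
    to one of the listed children, which gives the claim on labels.\<close>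
  moreover have "(\<Union>k\<in>{0..<Suc (count_list w n)}. set (root_child w k)) = set w - {n}"
    using root_slot_le[of _ w] le_n by (force simp: set_root_child less_Suc_eq_le simp flip: n_def)
  moreover have "labels (dec_tree (root_child w k)) = set (root_child w k)" for k
    by (rule IHl[OF length_root_child[OF less(2)]])
  ultimately show ?case using n by (auto simp flip: n_def simp del: upt_Suc)
qed

section \<open>Invariance under rewriting\<close>

text \<open>Gives both rules one shape, the exchange of an adjacent ascent in the presence of a
  witness, so that later arguments split only on the kind of witness.\<close>

lemma ms_rewrite_iff:
  "ms_rewrite u v \<longleftrightarrow> (\<exists>x a c s. u = x @ a # c # s \<and> v = x @ c # a # s \<and> a < c \<and>
    (a \<in> set s \<or> (\<exists>b. a < b \<and> b < c \<and> b \<in> set x \<and> b \<in> set s)))"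
  (is "_ \<longleftrightarrow> ?R")
proof
  assume "ms_rewrite u v"
  then show ?R
  proof cases
    case (1 a b x y z)
    then show ?thesis by (intro exI[of _ x] exI[of _ a] exI[of _ b] exI[of _ "y @ [a] @ z"]) auto
  next
    case (2 a b c x y z t)
    then show ?thesis
      by (intro exI[of _ "x @ [b] @ y"] exI[of _ a] exI[of _ c] exI[of _ "z @ [b] @ t"]) auto
  qed
next
  assume ?R
  then obtain x a c s where uv: "u = x @ a # c # s" "v = x @ c # a # s" "a < c"
    and or: "a \<in> set s \<or> (\<exists>b. a < b \<and> b < c \<and> b \<in> set x \<and> b \<in> set s)" by blast
  from or show "ms_rewrite u v"
  proof
    assume "a \<in> set s"
    then obtain y z where "s = y @ a # z" using split_list by fast
    then show ?thesis using ms_rewrite.intros(1)[of a c x y z] uv by simp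
  next
    assume "\<exists>b. a < b \<and> b < c \<and> b \<in> set x \<and> b \<in> set s"
    then obtain b where b: "a < b" "b < c" "b \<in> set x" "b \<in> set s" by blast
    obtain x1 x2 where "x = x1 @ b # x2" using split_list[OF b(3)] by blast
    moreover obtain s1 s2 where "s = s1 @ b # s2" using split_list[OF b(4)] by blast
    ultimately show ?thesis using ms_rewrite.intros(2)[OF b(1,2), of x1 x2 s1 s2] uv by simp
  qed
qed

lemma ms_rewrite_letters: "ms_rewrite u v \<Longrightarrow> count_list u = count_list v \<and> set u = set v \<and> length u = length v"
  by (auto simp: ms_rewrite_iff fun_eq_iff)

text \<open>If the last \<open>i\<close> lies outside the exchanged pair, the letters on each side
  of it are at most permuted. If it is \<open>c\<close>, only the smaller letter \<open>a\<close>
  crosses it. If it is \<open>a\<close>, the rewriting is an instance of rule (2), and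
  \<open>b < c\<close> encloses \<open>a\<close> in both words, so the moved \<open>c\<close> cannot
  be the least encloser.\<close>

lemma ms_rewrite_slot:
  assumes "ms_rewrite u v" "i \<in> set u" "i < Max (set u)"
  shows "slot u i = slot v i"
proof -
  obtain x a c s where uv: "u = x @ a # c # s" "v = x @ c # a # s" "a < c"
    and or: "a \<in> set s \<or> (\<exists>b. a < b \<and> b < c \<and> b \<in> set x \<and> b \<in> set s)"
    using assms(1) unfolding ms_rewrite_iff by blast
  have M: "Max (set u) = Max (set v)" and c: "count_list u (Max (set u)) = count_list v (Max (set u))"
    using ms_rewrite_letters[OF assms(1)] by auto
  note cong = slot_cong[OF _ _ _ _ M assms(3) c]
  consider "i \<in> set s" | "i \<notin> set s" "i = a" | "i \<notin> set s" "i = c" "i \<noteq> a"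
    | "i \<notin> set s" "i \<noteq> a" "i \<noteq> c" by blast
  then show ?thesis
  proof cases
    case 1
    obtain s1 s2 where "s = s1 @ i # s2" "i \<notin> set s2" using split_list_last[OF 1] by blast
    then show ?thesis
      by (intro cong[of "x @ a # c # s1" s2 "x @ c # a # s1" s2]) (auto simp: uv)
  next
    case 2
    then obtain b where b: "a < b" "b < c" "b \<in> set x" "b \<in> set s" using or by blast
    show ?thesis
    proof (rule cong[of x "c # s" "x @ [c]" s])
      fix j assume "i < j"
      show "count_list x j = count_list (x @ [c]) j \<and> (j \<in> set (c # s)) = (j \<in> set s) \<or>
         (\<exists>b>i. b < j \<and> b \<in> set x \<and> b \<in> set (c # s) \<and> b \<in> set (x @ [c]) \<and> b \<in> set s)"
      proof (cases "j = c")
        case True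
        then show ?thesis using b 2 by auto
      qed auto
    qed (use uv 2 in auto)
  next
    case 3
    then show ?thesis using uv(3)
      by (intro cong[of "x @ [a]" s x "a # s"]) (auto simp: uv(1,2))
  next
    case 4
    then have "i \<in> set x" using assms(2) uv by auto
    then obtain x1 x2 where "x = x1 @ i # x2" "i \<notin> set x2" using split_list_last by metis
    then show ?thesis using 4
      by (intro cong[of x1 "x2 @ a # c # s" x1 "x2 @ c # a # s"]) (auto simp: uv(1,2))
  qed
qed

lemma dec_tree_Node:
  "w \<noteq> [] \<Longrightarrow> dec_tree w = Node (Max (set w))
      (map (\<lambda>k. dec_tree (root_child w k)) [0..<Suc (count_list w (Max (set w)))])"
  using dec_tree_children by blast

text \<open>The roots agree, and corresponding children either coincide or are related by a
  rewriting again, which happens when both exchanged letters fall into the same child.\<close>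

lemma dec_tree_ms_rewrite: "ms_rewrite u v \<Longrightarrow> dec_tree u = dec_tree v"
proof (induction "length u" arbitrary: u v rule: less_induct)
  case less
  obtain x a c s where uv: "u = x @ a # c # s" "v = x @ c # a # s" "a < c"
    and or: "a \<in> set s \<or> (\<exists>b. a < b \<and> b < c \<and> b \<in> set x \<and> b \<in> set s)"
    using less(2) unfolding ms_rewrite_iff by blast
  have ne: "u \<noteq> []" "v \<noteq> []" using uv by auto
  define n where "n = Max (set u)"
  have nv: "Max (set v) = n" using ms_rewrite_letters[OF less(2)] by (simp add: n_def)
  have cv: "count_list v n = count_list u n" using ms_rewrite_letters[OF less(2)] by simp
  have le_n: "y \<le> n" if "y \<in> set u" for y using that unfolding n_def by (intro Max_ge) simp_all
  have rs: "root_slot u y = root_slot v y" if "y \<in> set u" "y < n" for y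
  proof (rule root_slot_cong)
    show "y \<in> set u" "y < Max (set u)" using that by (simp_all only: n_def)
    show "Max (set u) = Max (set v)" using nv by (simp only: n_def)
    fix z assume "z \<in> set u" "z < Max (set u)"
    then show "z \<in> set v \<and> slot u z = slot v z"
      using ms_rewrite_letters[OF less(2)] ms_rewrite_slot[OF less(2)] by blast
  qed
  have "dec_tree (root_child u k) = dec_tree (root_child v k)" for k
  proof -
    define F where "F y \<longleftrightarrow> y \<noteq> n \<and> root_slot u y = k" for y
    have u: "root_child u k = filter F u"
      unfolding root_child_def F_def n_def ..
    have v: "root_child v k = filter F v"
      unfolding root_child_def nv
    proof (rule filter_cong[OF refl])
      fix y assume "y \<in> set v"
      then have "y \<in> set u" using ms_rewrite_letters[OF less(2)] by simp
      then show "(y \<noteq> n \<and> root_slot v y = k) = F y"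
        using rs[of y] le_n[of y] by (cases "y = n") (auto simp: F_def)
    qed
    show ?thesis
    proof (cases "F a \<and> F c")
      case False
      then have "filter F u = filter F v" by (auto simp: uv)
      then show ?thesis using u v by simp
    next
      case True
      have "ms_rewrite (filter F u) (filter F v)"
        unfolding ms_rewrite_iff
      proof (intro exI conjI)
        show "filter F u = filter F x @ a # c # filter F s"
          "filter F v = filter F x @ c # a # filter F s" using True uv by auto
        show "a < c" by (rule uv)
        show "a \<in> set (filter F s) \<or>
          (\<exists>b>a. b < c \<and> b \<in> set (filter F x) \<and> b \<in> set (filter F s))"
        proof (cases "a \<in> set s")
          case True
          then show ?thesis using \<open>F a \<and> F c\<close> by simp
        next
          case False
          then obtain b where b: "a < b" "b < c" "b \<in> set x" "b \<in> set s" using or by blast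
          \<comment> \<open>The given \<open>b\<close> is not known to lie in this child, so it is
            replaced by the least encloser of \<open>a\<close> in \<open>u\<close>, where the last
            \<open>a\<close> is followed by \<open>c # s\<close>.\<close>
          define j where "j = (LEAST j. a < j \<and> j \<in> set x \<and> j \<in> set (c # s))"
          have "a < b \<and> b \<in> set x \<and> b \<in> set (c # s)" using b by simp
          then have j: "a < j" "j \<in> set x" "j \<in> set (c # s)"
            and jle: "\<And>j'. a < j' \<Longrightarrow> j' \<in> set x \<Longrightarrow> j' \<in> set (c # s) \<Longrightarrow> j \<le> j'"
            unfolding j_def using LeastI[of "\<lambda>j. a < j \<and> j \<in> set x \<and> j \<in> set (c # s)" b]
            by (auto intro: Least_le)
          have jb: "j \<le> b" by (rule jle) (use b in auto)
          \<comment> \<open>From \<open>j \<le> b < c \<le> n\<close> the node \<open>j\<close> is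
            not the root, hence shares the child of \<open>a\<close>; also \<open>j\<close> differs
            from \<open>c\<close>, so it occurs in \<open>s\<close>.\<close>
          have cn: "c \<le> n" by (rule le_n) (simp add: uv)
          have "slot u a = (j, count_list x j)"
            unfolding uv(1) by (rule slot_least_encloser) (use False uv(3) j jle in auto)
          then have "root_slot u a = root_slot u j"
            by (rule root_slot_step) (use jb b cn uv n_def in auto)
          then have "F j" using True jb b cn by (auto simp: F_def)
          then show ?thesis using j jb b by auto
        qed
      qed
      moreover have "length (filter F u) < length u" using length_root_child[OF ne(1), of k] u by simp
      ultimately show ?thesis using less(1) u v by simp
    qed
  qed
  then show ?case
    unfolding dec_tree_Node[OF ne(1)] dec_tree_Node[OF ne(2)] nv n_def[symmetric] cv by simp
qed

section \<open>Aba-free words\<close>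

definition aba_free :: "word \<Rightarrow> bool" where
  "aba_free w \<longleftrightarrow> (\<forall>p b r a. w = p @ b # r \<longrightarrow> a < b \<longrightarrow> a \<in> set p \<longrightarrow> a \<notin> set r)"

lemma aba_freeD: "aba_free (p @ b # r) \<Longrightarrow> a < b \<Longrightarrow> a \<in> set p \<Longrightarrow> a \<notin> set r"
  by (auto simp: aba_free_def)

lemma filter_eq_append_ConsD:
  "filter P w = p @ b # r \<Longrightarrow> \<exists>p' r'. w = p' @ b # r' \<and> filter P p' = p \<and> filter P r' = r"
proof (induction p arbitrary: w)
  case Nil
  then have "filter P w = b # r" by simp
  from filter_eq_ConsD[OF this] show ?case by (auto intro: filter_empty_conv[THEN iffD2])
next
  case (Cons x p)
  then have "filter P w = x # p @ b # r" by simp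
  from filter_eq_ConsD[OF this] obtain us vs where w: "w = us @ x # vs"
    and us: "\<forall>u\<in>set us. \<not> P u" and x: "P x" and vs: "p @ b # r = filter P vs" by auto
  obtain p' r' where "vs = p' @ b # r'" "filter P p' = p" "filter P r' = r"
    using Cons.IH[OF vs[symmetric]] by blast
  then show ?case using w us x
    by (intro exI[of _ "us @ x # p'"] exI[of _ r']) (auto simp: filter_empty_conv)
qed

lemma aba_free_filter: 
  assumes "aba_free w"
  shows "aba_free (filter P w)"
  unfolding aba_free_def
proof (intro allI impI)
  fix p b r a assume *: "filter P w = p @ b # r" "a < b" "a \<in> set p"
  obtain p' r' where w: "w = p' @ b # r'" "filter P p' = p" "filter P r' = r"
    using filter_eq_append_ConsD[OF *(1)] by blast
  then show "a \<notin> set r" using aba_freeD[of p' b r' a] assms * by auto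
qed

text \<open>No larger \<open>n\<close> lies between two occurrences of \<open>x\<close>, so the
  count of \<open>n\<close> to the left can be read at any occurrence and not only at the
  last.\<close>

lemma aba_free_count_before:
  assumes "aba_free w" "w = p @ x # s" "w = p' @ x # s'" "x < n"
  shows "count_list p n = count_list p' n"
proof -
  have *: "count_list p n = count_list p' n"
    if "p @ x # s = p' @ x # s'" "aba_free (p @ x # s)" "length p \<le> length p'" for p s p' s'
  proof -
    define d where "d = drop (length p) p'"
    have "take (length p) p' = p"
      using arg_cong[OF that(1), of "take (length p)"] that(3) by simp
    then have p': "p' = p @ d" by (metis append_take_drop_id d_def)
    have d: "p' = p @ d" "x # s = d @ x # s'" using that(1) unfolding p' by simp_all
    show ?thesis
    proof (cases d)
      case (Cons y m)
      then have m: "y = x" "s = m @ x # s'" using d by auto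
      have "n \<notin> set m"
      proof
        assume "n \<in> set m"
        then obtain m1 m2 where "m = m1 @ n # m2" using split_list by fast
        then show False using that(2) m aba_freeD[of "p @ x # m1" n "m2 @ x # s'" x] assms(4) by simp
      qed
      then show ?thesis using d Cons m assms(4) by simp
    qed (use d in simp)
  qed
  show ?thesis
    using *[of p s p' s'] *[of p' s' p s] assms(1-3) by (metis nat_le_linear)
qed

text \<open>The climb never crosses the maximum: an encloser \<open>j\<close> occurs on both sides
  of \<open>i\<close>, and a maximum between its left occurrence and \<open>i\<close> would lie
  between two letters \<open>j\<close>.\<close>

lemma aba_free_root_slot:
  assumes "aba_free w" "x \<in> set w" "x < Max (set w)"
  shows "w = p @ x # s \<Longrightarrow> root_slot w x = count_list p (Max (set w))"
  using assms(2,3)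
proof (induction arbitrary: p s rule: letter_induct)
  case (root i k)
  have "k = count_list p (Max (set w))"
    using root(1)
  proof (cases rule: slot_cases)
    case (enclosed p' s' j)
    then have "k = count_list p' (Max (set w))" using root(3) by (metis prod.inject)
    then show ?thesis using aba_free_count_before[OF assms(1) enclosed(1) root(4) root(2)] by simp
  next
    case (free p' s')
    then have k: "k = (if Max (set w) \<notin> set p' then 0 else count_list w (Max (set w)))"
      using root by simp
    have "count_list w (Max (set w)) = count_list p' (Max (set w)) + count_list s' (Max (set w))"
      using root(2) by (subst free(1)) simp
    \<comment> \<open>The maximum does not occur on both sides of \<open>i\<close>, so either none
      or all of its occurrences precede \<open>i\<close>.\<close>
    then have "k = count_list p' (Max (set w))"
      using free(3)[OF root(2)] k by (auto simp: count_list_0_iff)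
    then show ?thesis using aba_free_count_before[OF assms(1) free(1) root(4) root(2)] by simp
  qed
  then show ?case using root_slot_root[OF root(3)] by simp
next
  case (step i j k)
  let ?n = "Max (set w)"
  have in': "i < ?n" using step by simp
  from step(1) show ?case
  proof (cases rule: slot_cases)
    case (enclosed p' s' j')
    have [simp]: "j' = j" using enclosed step by simp
    obtain p1 p2 where p': "p' = p1 @ j # p2" using split_list enclosed by fastforce
    obtain s1 s2 where s': "s' = s1 @ j # s2" using split_list enclosed by fastforce
    have "?n \<notin> set p2"
    proof
      assume "?n \<in> set p2"
      then obtain q1 q2 where "p2 = q1 @ ?n # q2" using split_list by fast
      then have "w = (p1 @ j # q1) @ ?n # (q2 @ i # s1 @ j # s2)"
        using enclosed(1) p' s' by simp
      then show False
        using assms(1) aba_freeD[of "p1 @ j # q1" ?n "q2 @ i # s1 @ j # s2" j] step(4) by simp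
    qed
    then have "count_list p' ?n = count_list p1 ?n" using p' step(4) by simp
    moreover have "root_slot w j = count_list p1 ?n"
      by (rule step(6)[of _ "p2 @ i # s'"]) (use enclosed p' in simp)
    moreover have "root_slot w i = root_slot w j"
      by (rule root_slot_step[OF step(5)]) (use step in' in auto)
    ultimately show ?thesis
      using aba_free_count_before[OF assms(1) enclosed(1) step(7) in'] by simp
  qed (use step in auto)
qed

section \<open>Recovering an aba-free word from its tree\<close>

fun join :: "'a \<Rightarrow> 'a list list \<Rightarrow> 'a list" where
  "join n [] = []"
| "join n [b] = b"
| "join n (b # bs) = b @ n # join n bs"

lemma join_Cons_append: "join n ((x # b) # bs) = x # join n (b # bs)"
  by (cases bs) auto

text \<open>If \<open>f\<close> numbers each letter by the separators \<open>n\<close> before it,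
  the level sets of \<open>f\<close> are the blocks between separators. The offset \<open>c\<close>
  counts separators already passed and makes the induction work.\<close>

lemma join_blocks:
  assumes "\<And>p x s. w = p @ x # s \<Longrightarrow> x \<noteq> n \<Longrightarrow> f x = c + count_list p n"
  shows "join n (map (\<lambda>k. filter (\<lambda>x. x \<noteq> n \<and> f x = k) w) [c..<c + Suc (count_list w n)]) = w"
  using assms
proof (induction w arbitrary: c)
  case (Cons y w)
  have upt: "[c..<c + Suc m] = c # [Suc c..<c + Suc m]" for m
    by (simp add: upt_conv_Cons del: upt_Suc)
  show ?case
  proof (cases "y = n")
    case True
    have f: "f x = Suc c + count_list p n" if "w = p @ x # s" "x \<noteq> n" for p x s
      using Cons.prems[of "y # p" x s] that True by simp
    \<comment> \<open>After a leading \<open>n\<close> all indices exceed \<open>c\<close>: block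
      \<open>c\<close> is empty and the tail supplies the blocks from \<open>Suc c\<close>
      on.\<close>
    have "filter (\<lambda>x. x \<noteq> n \<and> f x = c) w = []"
      unfolding filter_empty_conv using f by (metis split_list not_add_less1 lessI add_Suc_shift less_add_Suc1)
    moreover have "join n (map (\<lambda>k. filter (\<lambda>x. x \<noteq> n \<and> f x = k) w) [Suc c..<Suc c + Suc (count_list w n)]) = w"
      by (rule Cons.IH) (rule f)
    moreover have "[Suc c..<Suc c + Suc (count_list w n)] = Suc c # [Suc (Suc c)..<Suc c + Suc (count_list w n)]"
      by (simp add: upt_conv_Cons del: upt_Suc)
    ultimately show ?thesis using True upt[of "count_list (y # w) n"] by (simp del: upt_Suc)
  next
    case False
    have fy: "f y = c" using Cons.prems[of "[]" y w] False by simp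
    have "join n (map (\<lambda>k. filter (\<lambda>x. x \<noteq> n \<and> f x = k) w) [c..<c + Suc (count_list w n)]) = w"
    proof (rule Cons.IH)
      fix p x s assume "w = p @ x # s" "x \<noteq> n"
      then show "f x = c + count_list p n" using Cons.prems[of "y # p" x s] False by simp
    qed
    note IH = this[unfolded upt list.map]
    have mp: "map (\<lambda>k. filter (\<lambda>x. x \<noteq> n \<and> f x = k) (y # w)) [Suc c..<c + Suc (count_list w n)]
      = map (\<lambda>k. filter (\<lambda>x. x \<noteq> n \<and> f x = k) w) [Suc c..<c + Suc (count_list w n)]"
      using fy by (intro map_cong) auto
    have c: "count_list (y # w) n = count_list w n" using False by simp
    show ?thesis unfolding c upt list.map mp
      using False fy IH by (simp add: join_Cons_append del: upt_Suc)
  qed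
qed simp

lemma aba_free_join_root_child:
  assumes "aba_free w" "w \<noteq> []"
  shows "join (Max (set w)) (map (root_child w) [0..<Suc (count_list w (Max (set w)))]) = w"
proof -
  have "join (Max (set w)) (map (\<lambda>k. filter (\<lambda>x. x \<noteq> Max (set w) \<and> root_slot w x = k) w)
      [0..<0 + Suc (count_list w (Max (set w)))]) = w"
  proof (rule join_blocks)
    fix p x s assume w: "w = p @ x # s" "x \<noteq> Max (set w)"
    then have "x \<in> set w" by simp
    moreover from this have "x < Max (set w)"
      using w(2) Max_ge[of "set w" x] by (metis List.finite_set nless_le)
    ultimately show "root_slot w x = 0 + count_list p (Max (set w))"
      using aba_free_root_slot[OF assms(1)] w(1) by simp
  qed
  moreover have "root_child w = (\<lambda>k. filter (\<lambda>x. x \<noteq> Max (set w) \<and> root_slot w x = k) w)"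
    by (simp add: root_child_def fun_eq_iff)
  ultimately show ?thesis by simp
qed

text \<open>The root gives the maximum, the number of its subtrees gives the multiplicity, and the
  subtrees determine the children by induction; joining these restores the word.\<close>

lemma dec_tree_inj_aba_free:
  "aba_free u \<Longrightarrow> aba_free v \<Longrightarrow> dec_tree u = dec_tree v \<Longrightarrow> u = v"
proof (induction "length u" arbitrary: u v rule: less_induct)
  case less
  show ?case
  proof (cases "u = [] \<or> v = []")
    case True
    then show ?thesis using less(4) dec_tree_Node[of u] dec_tree_Node[of v] by (metis dec_tree_Nil dtree.distinct(1))
  next
    case False
    then have ne: "u \<noteq> []" "v \<noteq> []" by auto
    note eq = less(4)[unfolded dec_tree_Node[OF ne(1)] dec_tree_Node[OF ne(2)] dtree.inject]
    define m where "m = Suc (count_list u (Max (set u)))"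
    have M: "Max (set u) = Max (set v)" using eq by blast
    have "length [0..<Suc (count_list u (Max (set u)))] = length [0..<Suc (count_list v (Max (set v)))]"
      using eq by (metis length_map)
    then have c: "Suc (count_list v (Max (set v))) = m" by (simp add: m_def)
    have mp: "map (\<lambda>k. dec_tree (root_child u k)) [0..<m] = map (\<lambda>k. dec_tree (root_child v k)) [0..<m]"
      using conjunct2[OF eq] unfolding c m_def[symmetric] .
    have "root_child u k = root_child v k" if "k < m" for k
    proof (rule less(1)[OF length_root_child[OF ne(1)]])
      show "aba_free (root_child u k)" "aba_free (root_child v k)"
        using less(2,3) aba_free_filter unfolding root_child_def by blast+
      show "dec_tree (root_child u k) = dec_tree (root_child v k)"
        using mp that by (simp add: list_eq_iff_nth_eq)
    qed
    then have "map (root_child u) [0..<m] = map (root_child v) [0..<m]" by simp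
    then show ?thesis
      using aba_free_join_root_child[OF less(2) ne(1)] aba_free_join_root_child[OF less(3) ne(2)]
        M c m_def by metis
  qed
qed

section \<open>Inversions and maximal words\<close>

lemma inversions_Cons: "inversions (x # w) = length (filter (\<lambda>y. y < x) w) + inversions w"
proof -
  let ?I = "\<lambda>w. {(p, q). p < q \<and> q < length w \<and> w ! p > w ! q}"
  have fin: "finite (?I w)" for w :: word
    by (rule finite_subset[of _ "{..<length w} \<times> {..<length w}"]) auto
  have "?I (x # w) = (\<lambda>q. (0, Suc q)) ` {q. q < length w \<and> w ! q < x} \<union> map_prod Suc Suc ` ?I w"
    (is "_ = ?A \<union> ?B")
  proof (rule set_eqI)
    fix z show "z \<in> ?I (x # w) \<longleftrightarrow> z \<in> ?A \<union> ?B"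
    proof (cases z)
      case (Pair p q)
      then show ?thesis by (cases p; cases q) (auto simp: image_iff)
    qed
  qed
  then have "inversions (x # w) = card (?A \<union> ?B)" unfolding inversions_def by (rule arg_cong)
  also have "\<dots> = card ?A + card ?B"
    by (rule card_Un_disjoint) (use fin in auto)
  also have "card ?A = length (filter (\<lambda>y. y < x) w)"
    by (subst card_image) (auto simp: inj_on_def length_filter_conv_card)
  also have "card ?B = inversions w"
    unfolding inversions_def by (rule card_image) (auto simp: inj_on_def)
  finally show ?thesis .
qed

text \<open>Equal filter lengths, as for rearrangements of one another, make each prefix letter form
  equally many inversions with either word.\<close>

lemma inversions_append_mono:
  "inversions u < inversions v \<Longrightarrow> (\<And>P. length (filter P u) = length (filter P v)) \<Longrightarrow>
    inversions (x @ u) < inversions (x @ v)"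
  by (induction x) (auto simp: inversions_Cons)

lemma ms_rewrite_inversions: "ms_rewrite u v \<Longrightarrow> inversions u < inversions v"
  unfolding ms_rewrite_iff by (auto intro!: inversions_append_mono simp: inversions_Cons)

lemma inversions_le: "inversions w \<le> length w * length w"
proof -
  have "inversions w \<le> card ({..<length w} \<times> {..<length w})"
    unfolding inversions_def by (rule card_mono) auto
  then show ?thesis by (simp add: card_cartesian_product)
qed

text \<open>After the left \<open>a\<close>, take the first letter \<open>c > a\<close> and its left
  neighbour \<open>y \<le> a\<close>. If \<open>y = a\<close>, rule (1) applies because
  \<open>a\<close> recurs on the right; if \<open>y < a\<close>, rule (2) applies with
  \<open>a\<close> as the enclosing letter.\<close>

lemma inv_maximal_aba_free:
  assumes "inv_maximal w"
  shows "aba_free w"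
  unfolding aba_free_def
proof (intro allI impI notI)
  fix p b r a assume w: "w = p @ b # r" "a < b" "a \<in> set p" "a \<in> set r"
  obtain p1 p2 where p: "p = p1 @ a # p2" using split_list[OF w(3)] by blast
  define t where "t = takeWhile (\<lambda>y. y \<le> a) (p2 @ [b])"
  define d where "d = dropWhile (\<lambda>y. y \<le> a) (p2 @ [b])"
  have td: "p2 @ [b] = t @ d" unfolding t_def d_def by (rule takeWhile_dropWhile_id[symmetric])
  \<comment> \<open>The final \<open>b > a\<close> guarantees that such a \<open>c\<close>
    exists.\<close>
  have "d \<noteq> []" unfolding d_def using w(2) by (auto simp: dropWhile_eq_Nil_conv)
  then obtain c d' where d: "d = c # d'" by (cases d) auto
  have ac: "a < c" using hd_dropWhile[of "\<lambda>y. y \<le> a" "p2 @ [b]"] d \<open>d \<noteq> []\<close>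
    unfolding d_def[symmetric] by simp
  obtain h y where hy: "a # t = h @ [y]" by (metis list.distinct(1) rev_exhaust)
  have "y \<in> set (a # t)" using hy by simp
  then have ya: "y \<le> a" by (auto simp: t_def dest: set_takeWhileD)
  have "p2 @ b # r = (p2 @ [b]) @ r" by simp
  then have "w = p1 @ (a # t) @ c # d' @ r" using w(1) p td d by simp
  then have we: "w = (p1 @ h) @ y # c # (d' @ r)" using hy by simp
  have "y = a \<or> a \<in> set (p1 @ h)" using hy by (cases h) auto
  then have "ms_rewrite w ((p1 @ h) @ c # y # (d' @ r))"
    unfolding ms_rewrite_iff using we ya ac w(4)
    by (intro exI[of _ "p1 @ h"] exI[of _ y] exI[of _ c] exI[of _ "d' @ r"]) (auto simp: le_less)
  then show False using assms ms_rewrite_inversions unfolding inv_maximal_def by blast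
qed

section \<open>Metasylvester classes\<close>

lemma ms_equiv_letters:
  "equivclp ms_rewrite u v \<Longrightarrow> count_list u = count_list v \<and> set u = set v \<and> length u = length v"
proof (induction rule: equivclp_induct)
  case (step y z)
  then show ?case using ms_rewrite_letters[of y z] ms_rewrite_letters[of z y] by auto
qed simp

lemma dec_tree_equiv: "equivclp ms_rewrite u v \<Longrightarrow> dec_tree u = dec_tree v"
proof (induction rule: equivclp_induct)
  case (step y z)
  then show ?case using dec_tree_ms_rewrite[of y z] dec_tree_ms_rewrite[of z y] by auto
qed simp

lemma equiv_ms_rel: "equiv words ms_rel"
proof (rule equivI)
  show "ms_rel \<subseteq> words \<times> words" by (auto simp: ms_rel_def)
  show "refl_on words ms_rel" by (auto simp: refl_on_def ms_rel_def)
  show "sym ms_rel" by (auto simp: sym_def ms_rel_def intro: equivclp_sym)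
  show "trans ms_rel" by (auto simp: trans_def ms_rel_def intro: equivclp_trans)
qed

lemma ms_rel_words: "u \<in> words \<Longrightarrow> equivclp ms_rewrite u v \<Longrightarrow> (u, v) \<in> ms_rel"
  using ms_equiv_letters[of u v] by (auto simp: ms_rel_def words_def in_lists_conv_set)

text \<open>Equivalent words have equal length, so their inversions are bounded; a word of the class
  with the most inversions is maximal.\<close>

lemma ex_inv_maximal: "\<exists>v. equivclp ms_rewrite u v \<and> inv_maximal v"
proof -
  have "inversions v < Suc (length u * length u)" if "equivclp ms_rewrite u v" for v
    using inversions_le[of v] ms_equiv_letters[OF that] by simp
  then obtain v where v: "equivclp ms_rewrite u v"
    and max: "\<And>v'. equivclp ms_rewrite u v' \<Longrightarrow> inversions v' \<le> inversions v"
    using ex_has_greatest_nat[of "equivclp ms_rewrite u" u inversions "Suc (length u * length u)"]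
    by auto
  have "inv_maximal v"
    unfolding inv_maximal_def
  proof
    assume "\<exists>w'. (ms_rewrite v w' \<or> ms_rewrite w' v) \<and> inversions v < inversions w'"
    then obtain w' where w': "ms_rewrite v w' \<or> ms_rewrite w' v" "inversions v < inversions w'"
      by blast
    then have "equivclp ms_rewrite u w'" using v equivclp_into_equivclp by metis
    then show False using max w'(2) by fastforce
  qed
  then show ?thesis using v by blast
qed

text \<open>Each word is equivalent to an aba-free one, and aba-free words with equal trees
  coincide.\<close>

lemma equiv_if_dec_tree_eq:
  assumes "dec_tree u = dec_tree v"
  shows "equivclp ms_rewrite u v"
proof -
  obtain u' where u': "equivclp ms_rewrite u u'" "inv_maximal u'" using ex_inv_maximal by blast
  obtain v' where v': "equivclp ms_rewrite v v'" "inv_maximal v'" using ex_inv_maximal by blast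
  have "dec_tree u' = dec_tree v'"
    using assms dec_tree_equiv u'(1) v'(1) by metis
  then have "u' = v'"
    using dec_tree_inj_aba_free inv_maximal_aba_free u'(2) v'(2) by blast
  then show ?thesis using u'(1) v'(1) equivclp_sym equivclp_trans by metis
qed

section \<open>Counting aba-free words\<close>

text \<open>With multiplicities listed from the smallest letter up, \<open>1 + sum_list xs\<close>
  is the number of gaps in a word made of the larger letters.\<close>

fun slot_product :: "nat list \<Rightarrow> nat" where
  "slot_product [] = 1"
| "slot_product (x # xs) = (1 + sum_list xs) * slot_product xs"

lemma slot_product_eq:
  "slot_product m = (\<Prod>k = 1..<length m. 1 + (\<Sum>l = k..<length m. m ! l))"
proof -
  \<comment> \<open>Starting the product at \<open>0\<close> gives a form stable under removing the
    head; the extra factor is \<open>1 + sum_list m\<close>.\<close>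
  have tail: "(\<Prod>k = 0..<length m. 1 + (\<Sum>l = k..<length m. m ! l)) = (1 + sum_list m) * slot_product m"
    if "m \<noteq> []" for m
    using that
  proof (induction m)
    case (Cons x xs)
    have "(\<Prod>k = 0..<Suc (length xs). 1 + (\<Sum>l = k..<Suc (length xs). (x # xs) ! l))
      = (1 + sum_list (x # xs)) * (\<Prod>k = 0..<length xs. 1 + (\<Sum>l = Suc k..<Suc (length xs). (x # xs) ! l))"
      by (subst prod.atLeast0_lessThan_Suc_shift)
        (simp add: sum_list_sum_nth sum.atLeast0_lessThan_Suc_shift del: sum.op_ivl_Suc)
    also have "(\<Prod>k = 0..<length xs. 1 + (\<Sum>l = Suc k..<Suc (length xs). (x # xs) ! l))
      = (\<Prod>k = 0..<length xs. 1 + (\<Sum>l = k..<length xs. xs ! l))"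
      by (simp add: sum.shift_bounds_Suc_ivl del: sum.op_ivl_Suc)
    also have "\<dots> = slot_product (x # xs)"
      using Cons.IH by (cases xs) simp_all
    finally show ?case by (simp del: slot_product.simps sum_list.Cons prod.op_ivl_Suc sum.op_ivl_Suc)
  qed simp
  show ?thesis
  proof (cases m)
    case (Cons x xs)
    have "(\<Prod>k = 1..<length m. 1 + (\<Sum>l = k..<length m. m ! l))
      = (\<Prod>k = 0..<length xs. 1 + (\<Sum>l = k..<length xs. xs ! l))"
      unfolding Cons
      by (simp add: sum.shift_bounds_Suc_ivl prod.shift_bounds_Suc_ivl del: sum.op_ivl_Suc prod.op_ivl_Suc)
    also have "\<dots> = slot_product m"
      using tail[of xs] Cons by (cases xs) simp_all
    finally show ?thesis by simp
  qed simp
qed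

lemma count_list_replicate: "count_list (replicate n x) y = (if x = y then n else 0)"
  by (induction n) auto

lemma filter_neq_id: "i \<notin> set w \<Longrightarrow> filter (\<lambda>x. x \<noteq> i) w = w"
  by (induction w) auto

text \<open>Takes a pair so that the words counted become the image of a Cartesian product of words
  and gaps.\<close>

definition insert_block :: "nat \<Rightarrow> nat \<Rightarrow> word \<times> nat \<Rightarrow> word" where
  "insert_block i c = (\<lambda>(w, k). take k w @ replicate c i @ drop k w)"

text \<open>As \<open>i\<close> is least, it can only be the repeated letter of a new forbidden
  pattern; the middle letter would then sit inside the block of copies of \<open>i\<close>.\<close>

lemma aba_free_insert_block:
  assumes "aba_free (t @ d)" "\<And>x. x \<in> set (t @ d) \<Longrightarrow> i < x"
  shows "aba_free (t @ replicate c i @ d)"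
  unfolding aba_free_def
proof (intro allI impI notI)
  fix p b r a
  assume e: "t @ replicate c i @ d = p @ b # r" and ab: "a < b" "a \<in> set p" "a \<in> set r"
  have "x = i \<or> x \<in> set (t @ d)" if "x \<in> set (p @ b # r)" for x
    using that unfolding e[symmetric] by auto
  then have ge: "i \<le> x" if "x \<in> set (p @ b # r)" for x
    using that assms(2)[of x] by fastforce
  have bi: "b \<noteq> i" using ge[of a] ab by auto
  have it: "i \<notin> set t" "i \<notin> set d" using assms(2)[of i] by auto
  have "filter (\<lambda>x. x \<noteq> i) (t @ replicate c i @ d) = t @ d"
    using it by (simp add: filter_neq_id filter_empty_conv)
  then have w: "t @ d = filter (\<lambda>x. x \<noteq> i) p @ b # filter (\<lambda>x. x \<noteq> i) r"
    unfolding e using bi by simp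
  show False
  proof (cases "a = i")
    case False
    then show ?thesis using assms(1) w aba_freeD ab by fastforce
  next
    case True
    \<comment> \<open>Since \<open>i\<close> occurs in \<open>p\<close> and \<open>r\<close> but not
      in \<open>t\<close> or \<open>d\<close>, the position of \<open>b\<close> falls within the
      inserted block.\<close>
    have "length t < length p"
    proof (rule ccontr)
      assume "\<not> length t < length p"
      then have "take (length p) t = p" using arg_cong[OF e, of "take (length p)"] by simp
      then show False using it(1) ab(2) True by (metis in_set_takeD)
    qed
    moreover have "length d < length r"
    proof (rule ccontr)
      assume *: "\<not> length d < length r"
      have "rev d @ rev (t @ replicate c i) = rev r @ rev (p @ [b])"
        using arg_cong[OF e, of rev] by simp
      from arg_cong[OF this, of "take (length r)"] have "take (length r) (rev d) = rev r"
        using * by simp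
      then show False using it(2) ab(3) True by (metis in_set_takeD set_rev)
    qed
    moreover have "b = (t @ replicate c i @ d) ! length p" unfolding e by simp
    moreover have "length t + c + length d = length p + 1 + length r"
      using arg_cong[OF e, of length] by simp
    moreover from calculation have "length p - length t < c" by linarith
    ultimately have "b = i" by (simp add: nth_append)
    then show False using bi by simp
  qed
qed

text \<open>The first letter after the initial run of \<open>i\<close> is larger than
  \<open>i\<close>, so no further \<open>i\<close> can follow it.\<close>

lemma aba_free_min_block:
  assumes "aba_free w" "i \<in> set w" "\<And>x. x \<in> set w \<Longrightarrow> i \<le> x"
  obtains p d where "w = p @ replicate (count_list w i) i @ d" "i \<notin> set p" "i \<notin> set d"
proof -
  obtain p q where w: "w = p @ i # q" "i \<notin> set p" using split_list_first[OF assms(2)] by blast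
  define t where "t = takeWhile (\<lambda>x. x = i) q"
  define d where "d = dropWhile (\<lambda>x. x = i) q"
  have q: "q = t @ d" by (simp add: t_def d_def)
  have "\<forall>x\<in>set t. x = i" by (auto simp: t_def dest: set_takeWhileD)
  then have t: "t = replicate (length t) i" by (metis replicate_length_same)
  have id: "i \<notin> set d"
  proof (cases d)
    case (Cons b d')
    have "b \<noteq> i" using hd_dropWhile[of "\<lambda>x. x = i" q] Cons unfolding d_def by fastforce
    moreover have "i \<le> b" using assms(3)[of b] w q Cons by simp
    ultimately have "i < b" by simp
    moreover have "aba_free ((p @ i # t) @ b # d')" using assms(1) w q Cons by simp
    ultimately have "i \<notin> set d'" using aba_freeD[of "p @ i # t" b d' i] by simp
    then show ?thesis using Cons \<open>b \<noteq> i\<close> by simp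
  qed simp
  have "count_list t i = length t" by (subst t) (simp add: count_list_replicate)
  moreover have "count_list p i = 0" "count_list d i = 0" using w id by (simp_all add: count_list_0_iff)
  ultimately have "count_list w i = Suc (length t)" using w q by simp
  then have "w = p @ replicate (count_list w i) i @ d" using w q t by simp
  then show thesis using that w(2) id by blast
qed

definition aba_free_words :: "(nat \<Rightarrow> nat) \<Rightarrow> word set" where
  "aba_free_words e = {w. count_list w = e \<and> aba_free w}"

text \<open>Removing the block of the smallest letter is a bijection onto pairs of an aba-free word
  in the other letters and a gap in it.\<close>

lemma card_aba_free_words:
  assumes "sorted_wrt (<) ls" "set ls = {i. e i \<noteq> 0}"
  shows "card (aba_free_words e) = slot_product (map e ls)"
  using assms
proof (induction ls arbitrary: e)
  case Nil
  then have e: "e = (\<lambda>_. 0)" by (auto simp: fun_eq_iff)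
  have "aba_free_words e = {[]}"
    by (auto simp: aba_free_words_def e aba_free_def fun_eq_iff count_list_0_iff)
  then show ?case by simp
next
  case (Cons i ls)
  define e' where "e' = e(i := 0)"
  have i: "i \<notin> set ls" "\<And>x. x \<in> set ls \<Longrightarrow> i < x" using Cons.prems(1) by auto
  have ei: "e i \<noteq> 0" using Cons.prems(2) by auto
  have e'_ls: "set ls = {i. e' i \<noteq> 0}" using Cons.prems(2) i(1) by (auto simp: e'_def)
  have map_e': "map e' ls = map e ls" using i(1) by (auto simp: e'_def)
  have IH: "card (aba_free_words e') = slot_product (map e ls)"
    using Cons.IH[OF _ e'_ls] Cons.prems(1) map_e' by simp
  let ?N = "sum_list (map e ls)"
  have set_e': "set w = set ls" if "count_list w = e'" for w
    unfolding e'_ls that[symmetric] by (auto simp: count_list_0_iff)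
  \<comment> \<open>All remaining words have the same length \<open>?N\<close>, so
    \<open>{..?N}\<close> lists their \<open>?N + 1\<close> gaps.\<close>
  have len: "length w = ?N" if "count_list w = e'" for w
  proof -
    have "distinct ls" using Cons.prems(1) by (auto simp: strict_sorted_iff)
    then have "sum_list (map e' ls) = sum (count_list w) (set w)"
      using set_e'[OF that] that by (simp add: sum_list_distinct_conv_sum_set)
    then show ?thesis using map_e' sum_count_set[of w "set w"] by simp
  qed
  have "aba_free_words e = insert_block i (e i) ` (aba_free_words e' \<times> {..?N})"
  proof (rule set_eqI, rule iffI)
    fix w assume "w \<in> aba_free_words e"
    then have w: "count_list w = e" "aba_free w" by (auto simp: aba_free_words_def)
    have "set w = set (i # ls)"
      unfolding Cons.prems(2) w(1)[symmetric] by (auto simp: count_list_0_iff)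
    then have "i \<in> set w" "\<And>x. x \<in> set w \<Longrightarrow> i \<le> x" using i(2) by (auto simp: le_less)
    then obtain p d where pd: "w = p @ replicate (count_list w i) i @ d" "i \<notin> set p" "i \<notin> set d"
      using aba_free_min_block[OF w(2)] by blast
    have f: "filter (\<lambda>x. x \<noteq> i) w = p @ d"
      by (subst pd(1)) (use pd(2,3) in \<open>simp add: filter_neq_id filter_empty_conv\<close>)
    have "count_list (p @ d) = e'"
      unfolding f[symmetric] e'_def w(1)[symmetric] by (auto simp: count_list_filter_if)
    moreover have "aba_free (p @ d)" unfolding f[symmetric] by (rule aba_free_filter[OF w(2)])
    ultimately have "(p @ d, length p) \<in> aba_free_words e' \<times> {..?N}"
      using len[of "p @ d"] by (simp add: aba_free_words_def)
    moreover have "w = insert_block i (e i) (p @ d, length p)"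
      using pd(1) w(1) by (simp add: insert_block_def)
    ultimately show "w \<in> insert_block i (e i) ` (aba_free_words e' \<times> {..?N})" by blast
  next
    fix w assume "w \<in> insert_block i (e i) ` (aba_free_words e' \<times> {..?N})"
    then obtain v k where v: "count_list v = e'" "aba_free v" and w: "w = insert_block i (e i) (v, k)"
      by (auto simp: aba_free_words_def)
    have "aba_free w" unfolding w
      unfolding insert_block_def case_prod_conv
      by (rule aba_free_insert_block) (use v set_e'[OF v(1)] i(2) in simp_all)
    moreover have "count_list w x = e x" for x
    proof -
      have "count_list w x = count_list (take k v @ drop k v) x + count_list (replicate (e i) i) x"
        unfolding w insert_block_def by (simp del: append_take_drop_id)
      also have "\<dots> = e' x + (if x = i then e i else 0)"
        using v(1) by (simp add: count_list_replicate)
      finally show ?thesis by (simp add: e'_def)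
    qed
    ultimately show "w \<in> aba_free_words e" by (simp add: aba_free_words_def fun_eq_iff)
  qed
  moreover have "inj_on (insert_block i (e i)) (aba_free_words e' \<times> {..?N})"
  proof (rule inj_onI, clarify)
    fix v k v' k'
    assume v: "v \<in> aba_free_words e'" "v' \<in> aba_free_words e'" and k: "k \<le> ?N" "k' \<le> ?N"
      and eq: "insert_block i (e i) (v, k) = insert_block i (e i) (v', k')"
    have iv: "i \<notin> set u" if "u \<in> aba_free_words e'" for u
      using that set_e'[of u] i(1) by (simp add: aba_free_words_def)
    \<comment> \<open>The prefix before the first \<open>i\<close> recovers the gap, which requires
      the block to be nonempty; deleting \<open>i\<close> recovers the word.\<close>
    have tw: "takeWhile (\<lambda>x. x \<noteq> i) (insert_block i (e i) (u, k)) = take k u"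
      if "u \<in> aba_free_words e'" for u k
    proof -
      have "replicate (e i) i = i # replicate (e i - 1) i" using ei by (cases "e i") auto
      moreover have "x \<noteq> i" if "x \<in> set (take k u)" for x
        using that iv[OF \<open>u \<in> aba_free_words e'\<close>] by (auto dest: in_set_takeD)
      ultimately show ?thesis by (simp add: insert_block_def takeWhile_append2)
    qed
    have fl: "filter (\<lambda>x. x \<noteq> i) (insert_block i (e i) (u, k)) = u" if "u \<in> aba_free_words e'" for u k
    proof -
      have "filter (\<lambda>x. x \<noteq> i) (insert_block i (e i) (u, k)) = filter (\<lambda>x. x \<noteq> i) (take k u @ drop k u)"
        by (simp add: insert_block_def filter_empty_conv del: append_take_drop_id)
      also have "\<dots> = u" using iv[OF that] by (simp add: filter_neq_id)
      finally show ?thesis .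
    qed
    have "v = v'" using fl[OF v(1)] fl[OF v(2)] eq by metis
    moreover have "take k v = take k' v'" using tw[OF v(1)] tw[OF v(2)] eq by metis
    then have "length (take k v) = length (take k' v')" by (rule arg_cong)
    then have "k = k'" using len[of v] len[of v'] v k by (simp add: aba_free_words_def)
    ultimately show "v = v' \<and> k = k'" by simp
  qed
  ultimately have "card (aba_free_words e) = card (aba_free_words e') * Suc ?N"
    by (simp add: card_image card_cartesian_product)
  then show ?case using IH by simp
qed

section \<open>The theorem\<close>

text \<open>Sending an aba-free word to its class is a bijection: a maximal word of the class gives
  surjectivity, and the tree gives injectivity.\<close>

lemma card_classes:
  assumes "is_evaluation e"
  shows "card ({w \<in> words. evaluation w = e} // ms_rel) = slot_product (packed_evaluation e)"
proof -
  let ?W = "{w \<in> words. evaluation w = e}"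
  \<comment> \<open>The convention \<open>e 0 = 0\<close> keeps the non-letter \<open>0\<close> out
    of every word with evaluation \<open>e\<close>.\<close>
  have words: "w \<in> words" if "count_list w = e" for w
  proof -
    have "count_list w 0 = 0" using assms that by (simp add: is_evaluation_def)
    then have "0 \<notin> set w" by (simp add: count_list_0_iff)
    then have "x \<ge> 1" if "x \<in> set w" for x using that by (cases x) auto
    then show ?thesis by (auto simp: words_def)
  qed
  then have W: "?W = {w. count_list w = e}" by (auto simp: evaluation_def fun_eq_iff)
  have "?W // ms_rel = (\<lambda>w. ms_rel `` {w}) ` aba_free_words e"
  proof (rule set_eqI, rule iffI)
    fix C assume "C \<in> ?W // ms_rel"
    then obtain u where u: "C = ms_rel `` {u}" "u \<in> words" "count_list u = e"
      unfolding W using words by (auto elim!: quotientE)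
    obtain v where v: "equivclp ms_rewrite u v" "inv_maximal v" using ex_inv_maximal by blast
    have "(u, v) \<in> ms_rel" by (rule ms_rel_words[OF u(2) v(1)])
    then have "C = ms_rel `` {v}" using u(1) equiv_class_eq[OF equiv_ms_rel] by blast
    moreover have "v \<in> aba_free_words e"
      using ms_equiv_letters[OF v(1)] inv_maximal_aba_free[OF v(2)] u(3)
      by (simp add: aba_free_words_def)
    ultimately show "C \<in> (\<lambda>w. ms_rel `` {w}) ` aba_free_words e" by blast
  next
    fix C assume "C \<in> (\<lambda>w. ms_rel `` {w}) ` aba_free_words e"
    then show "C \<in> ?W // ms_rel" unfolding W by (auto simp: aba_free_words_def intro: quotientI)
  qed
  moreover have "inj_on (\<lambda>w. ms_rel `` {w}) (aba_free_words e)"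
  proof (rule inj_onI)
    fix u v assume uv: "u \<in> aba_free_words e" "v \<in> aba_free_words e" "ms_rel `` {u} = ms_rel `` {v}"
    then have "v \<in> words" using words by (simp add: aba_free_words_def)
    then have "(u, v) \<in> ms_rel" using uv(3) eq_equiv_class[OF _ equiv_ms_rel] by blast
    then have "dec_tree u = dec_tree v" using dec_tree_equiv by (simp add: ms_rel_def)
    then show "u = v" using uv dec_tree_inj_aba_free by (simp add: aba_free_words_def)
  qed
  ultimately have "card (?W // ms_rel) = card (aba_free_words e)" by (simp add: card_image)
  also have "\<dots> = slot_product (packed_evaluation e)"
    unfolding packed_evaluation_def
    by (rule card_aba_free_words) (use assms in \<open>auto simp: is_evaluation_def\<close>)
  finally show ?thesis .
qed

lemma ms_class_eq_dec_tree:
  assumes "u \<in> words"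
  shows "ms_rel `` {u} = {v \<in> words. dec_tree v = dec_tree u}"
proof (rule set_eqI)
  fix v show "v \<in> ms_rel `` {u} \<longleftrightarrow> v \<in> {v \<in> words. dec_tree v = dec_tree u}"
    using assms dec_tree_equiv[of u v] equiv_if_dec_tree_eq[of u v] by (auto simp: ms_rel_def)
qed

text \<open>Maximal words are aba-free, and those of one class share a tree, which determines
  them.\<close>

lemma ex1_inv_maximal:
  assumes "C \<in> words // ms_rel"
  shows "\<exists>!w. w \<in> C \<and> inv_maximal w"
proof -
  obtain u where u: "C = ms_rel `` {u}" "u \<in> words" using assms by (auto elim: quotientE)
  obtain v where v: "equivclp ms_rewrite u v" "inv_maximal v" using ex_inv_maximal by blast
  show ?thesis
  proof (rule ex1I)
    show "v \<in> C \<and> inv_maximal v" using ms_rel_words[OF u(2) v(1)] v(2) u(1) by simp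
    fix w assume w: "w \<in> C \<and> inv_maximal w"
    then have "dec_tree w = dec_tree u" using ms_class_eq_dec_tree[OF u(2)] u(1) by blast
    also have "\<dots> = dec_tree v" by (rule dec_tree_equiv[OF v(1)])
    finally show "w = v" using dec_tree_inj_aba_free inv_maximal_aba_free w v(2) by blast
  qed
qed

theorem theorem3p9:
  shows "(\<forall>e m. is_evaluation e \<and> m = packed_evaluation e \<longrightarrow>
            card ({w \<in> words. evaluation w = e} // ms_rel)
              = (\<Prod>k = 1..<length m. 1 + (\<Sum>l = k..<length m. m ! l)))
       \<and> (\<forall>u \<in> words. packed u \<longrightarrow> ms_rel `` {u} = {v \<in> words. dec_tree v = dec_tree u})
       \<and> (\<forall>C \<in> words // ms_rel. \<exists>!w. w \<in> C \<and> inv_maximal w)"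
  using card_classes slot_product_eq ms_class_eq_dec_tree ex1_inv_maximal by auto

end
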